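(* Let $\Omega\subset\mathbb{R}^n$ be a bounded domain and $x_0\in\partial\Omega$. Let $\varphi\in\Phi_w(\mathbb{R}^n)$ satisfy (A0), (A1), (A1-$n$) and (aDec)$_q$. If $q<n$ and the measure density condition is satisfied at $x_0$, then the complement of $\Omega$ is locally $\varphi$-fat at $x_0$.
   Context: A function $g$ is $L$-almost increasing ($L\ge1$) if $g(s)\le Lg(t)$ for all $s\le t$; $L$-almost decreasing is defined analogously. Let $G\subset\mathbb{R}^n$ be open (here $G=\mathbb{R}^n$). A function $\varphi:G\times[0,\infty)\to[0,\infty]$ is a weak $\Phi$-function, $\varphi\in\Phi_w(G)$, if: $x\mapsto\varphi(x,t)$ is measurable for every $t\ge0$ and $t\mapsto\varphi(x,t)$ is increasing (non-strictly) for every $x\in G$; $\varphi(x,0)=\lim_{t\to0^+}\varphi(x,t)=0$ and $\lim_{t\to\infty}\varphi(x,t)=\infty$ for every $x\in G$; there is $L\ge1$ such that $t\mapsto\varphi(x,t)/t$ is $L$-almost increasing on $(0,\infty)$ for every $x\in G$; $t\mapsto\varphi(x,t)$ is left-continuous for $t>0$ for every $x\in G$. For a ball $B$ put $\varphi_B^+(t)=\sup_{x\in B\cap G}\varphi(x,t)$, $\varphi_B^-(t)=\inf_{x\in B\cap G}\varphi(x,t)$, and $\varphi^\pm(t)$ for the sup/inf over $x\in G$. The left inverse is $\varphi^{-1}(\tau)=\inf\{t\ge0:\varphi(t)\ge\tau\}$. Conditions: - (A0): there is $\beta\in(0,1)$ with $\varphi^+(\beta)\le1\le\varphi^-(1/\beta)$.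 - (A1): there is $\beta\in(0,1)$ such that for every ball $B$ with $B\cap G\ne\emptyset$, $\varphi_B^+(\beta t)\le\varphi_B^-(t)$ whenever $t\in[1,(\varphi_B^-)^{-1}(1/|B|)]$. - (A1-$n$): there is $\beta\in(0,1)$ such that for every ball $B$ with $B\cap G\ne\emptyset$, $\varphi_B^+(\beta t)\le\varphi_B^-(t)$ whenever $t\in[1,1/\operatorname{diam}(B)]$. - (aDec)$_q$: there is $L\ge1$ such that $t\mapsto\varphi(x,t)/t^q$ is $L$-almost decreasing on $(0,\infty)$ for every $x$. For an open set $U$, $L^\varphi(U)$ is the set of measurable $g$ with $\int_U\varphi(x,\lambda|g|)\,dx<\infty$ for some $\lambda>0$, with norm $\|g\|_{L^\varphi(U)}=\inf\{\lambda>0:\int_U\varphi(x,|g|/\lambda)\,dx\le1\}$; $W^{1,\varphi}(U)$ is the set of $u\in L^\varphi(U)$ whose weak partial derivatives lie in $L^\varphi(U)$, with norm $\|u\|_{L^\varphi(U)}+\|\nabla u\|_{L^\varphi(U)}$; $W^{1,\varphi}_0(U)$ is the closure of $C_0^\infty(U)$ in this norm. Capacity: for an open set $U$ and $E$ with compact closure contained in $U$, $C_\varphi(E,U)=\inf\int_U\varphi(x,|\nabla w|)\,dx$, the infimum over all $w\in W^{1,\varphi}_0(U)$ with $w\ge1$ in an open set containing $E$. Measure density condition at $x_0$: there are $c_*\in(0,1)$ and $R>0$ with $|B(x_0,r)\setminus\Omega|\ge c_*|B(x_0,r)|$ for all $0<r\le R$. The complement of $\Omega$ is locally $\varphi$-fat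 at $x_0$ (capacity fatness condition) if there are $c\in(0,1)$ and $R>0$ with $C_\varphi(B(x_0,r)\setminus\Omega,B(x_0,2r))\ge c\,C_\varphi(B(x_0,r),B(x_0,2r))$ for all $0<r\le R$. *)

theory Defs
  imports "HOL-Analysis.Analysis"
begin

section \<open>Generalized \<open>\<Phi>\<close>-functions\<close>

definition almost_increasing_on :: "real \<Rightarrow> real set \<Rightarrow> (real \<Rightarrow> ennreal) \<Rightarrow> bool" where
  "almost_increasing_on L S g \<longleftrightarrow> (\<forall>s\<in>S. \<forall>t\<in>S. s \<le> t \<longrightarrow> g s \<le> ennreal L * g t)"

definition almost_decreasing_on :: "real \<Rightarrow> real set \<Rightarrow> (real \<Rightarrow> ennreal) \<Rightarrow> bool" where
  "almost_decreasing_on L S g \<longleftrightarrow> (\<forall>s\<in>S. \<forall>t\<in>S. s \<le> t \<longrightarrow> g t \<le> ennreal L * g s)"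

text \<open>A function \<open>G \<times> [0,\<infinity>) \<rightarrow> [0,\<infinity>]\<close> is rendered as a total function
  into \<^typ>\<open>ennreal\<close>; its values for \<open>x \<notin> G\<close> or \<open>t < 0\<close> are never used.\<close>

definition weak_Phi :: "'a::euclidean_space set \<Rightarrow> ('a \<Rightarrow> real \<Rightarrow> ennreal) \<Rightarrow> bool" where
  "weak_Phi G \<phi> \<longleftrightarrow>
     (\<forall>t\<ge>0. (\<lambda>x. \<phi> x t) \<in> borel_measurable (lebesgue_on G)) \<and>
     (\<forall>x\<in>G. mono_on {0..} (\<phi> x)) \<and>
     (\<forall>x\<in>G. \<phi> x 0 = 0 \<and> (\<phi> x \<longlongrightarrow> 0) (at_right 0) \<and> (\<phi> x \<longlongrightarrow> \<infinity>) at_top) \<and>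
     (\<exists>L\<ge>1. \<forall>x\<in>G. almost_increasing_on L {0<..} (\<lambda>t. \<phi> x t / ennreal t)) \<and>
     (\<forall>x\<in>G. \<forall>t>0. continuous (at_left t) (\<phi> x))"

definition phi_plus :: "('a \<Rightarrow> real \<Rightarrow> ennreal) \<Rightarrow> 'a set \<Rightarrow> real \<Rightarrow> ennreal" where
  "phi_plus \<phi> A t = (SUP x\<in>A. \<phi> x t)"

definition phi_minus :: "('a \<Rightarrow> real \<Rightarrow> ennreal) \<Rightarrow> 'a set \<Rightarrow> real \<Rightarrow> ennreal" where
  "phi_minus \<phi> A t = (INF x\<in>A. \<phi> x t)"

text \<open>The left inverse takes extended values, so that the infimum of the empty set is \<open>\<infinity>\<close>.\<close>

definition left_inverse :: "(real \<Rightarrow> ennreal) \<Rightarrow> ennreal \<Rightarrow> ennreal" where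
  "left_inverse f \<tau> = (INF t\<in>{t. 0 \<le> t \<and> f t \<ge> \<tau>}. ennreal t)"

definition A0 :: "'a::euclidean_space set \<Rightarrow> ('a \<Rightarrow> real \<Rightarrow> ennreal) \<Rightarrow> bool" where
  "A0 G \<phi> \<longleftrightarrow> (\<exists>\<beta>. 0 < \<beta> \<and> \<beta> < 1 \<and> phi_plus \<phi> G \<beta> \<le> 1 \<and> 1 \<le> phi_minus \<phi> G (1 / \<beta>))"

definition A1 :: "'a::euclidean_space set \<Rightarrow> ('a \<Rightarrow> real \<Rightarrow> ennreal) \<Rightarrow> bool" where
  "A1 G \<phi> \<longleftrightarrow> (\<exists>\<beta>. 0 < \<beta> \<and> \<beta> < 1 \<and>
     (\<forall>z r. 0 < r \<and> ball z r \<inter> G \<noteq> {} \<longrightarrow>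
       (\<forall>t\<ge>1. ennreal t \<le> left_inverse (phi_minus \<phi> (ball z r \<inter> G)) (1 / emeasure lebesgue (ball z r))
          \<longrightarrow> phi_plus \<phi> (ball z r \<inter> G) (\<beta> * t) \<le> phi_minus \<phi> (ball z r \<inter> G) t)))"

definition A1_n :: "'a::euclidean_space set \<Rightarrow> ('a \<Rightarrow> real \<Rightarrow> ennreal) \<Rightarrow> bool" where
  "A1_n G \<phi> \<longleftrightarrow> (\<exists>\<beta>. 0 < \<beta> \<and> \<beta> < 1 \<and>
     (\<forall>z r. 0 < r \<and> ball z r \<inter> G \<noteq> {} \<longrightarrow>
       (\<forall>t\<in>{1..1 / diameter (ball z r)}.
          phi_plus \<phi> (ball z r \<inter> G) (\<beta> * t) \<le> phi_minus \<phi> (ball z r \<inter> G) t)))"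

definition aDec :: "real \<Rightarrow> 'a::euclidean_space set \<Rightarrow> ('a \<Rightarrow> real \<Rightarrow> ennreal) \<Rightarrow> bool" where
  "aDec q G \<phi> \<longleftrightarrow>
     (\<exists>L\<ge>1. \<forall>x\<in>G. almost_decreasing_on L {0<..} (\<lambda>t. \<phi> x t / ennreal (t powr q)))"

section \<open>Test functions and weak gradients\<close>

text \<open>Functions of class \<open>C\<^sup>k\<close> on the whole space.\<close>

primrec Ck :: "nat \<Rightarrow> ('a::euclidean_space \<Rightarrow> real) \<Rightarrow> bool" where
  "Ck 0 f \<longleftrightarrow> continuous_on UNIV f"
| "Ck (Suc k) f \<longleftrightarrow> (\<forall>x. f differentiable (at x)) \<and>
     (\<forall>b\<in>Basis. Ck k (\<lambda>x. frechet_derivative f (at x) b))"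

text \<open>\<open>C\<^sub>0\<^sup>\<infinity>(U)\<close>, its elements being extended by zero to the whole space.\<close>

definition test_functions :: "'a::euclidean_space set \<Rightarrow> ('a \<Rightarrow> real) set" where
  "test_functions U = {\<eta>. (\<forall>k. Ck k \<eta>) \<and>
     compact (closure {x. \<eta> x \<noteq> 0}) \<and> closure {x. \<eta> x \<noteq> 0} \<subseteq> U}"

definition locally_integrable_on :: "('a::euclidean_space \<Rightarrow> real) \<Rightarrow> 'a set \<Rightarrow> bool" where
  "locally_integrable_on u U \<longleftrightarrow> (\<forall>K. compact K \<and> K \<subseteq> U \<longrightarrow> u absolutely_integrable_on K)"

definition has_weak_partial ::
  "'a::euclidean_space set \<Rightarrow> 'a \<Rightarrow> ('a \<Rightarrow> real) \<Rightarrow> ('a \<Rightarrow> real) \<Rightarrow> bool" where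
  "has_weak_partial U b u v \<longleftrightarrow> locally_integrable_on u U \<and> locally_integrable_on v U \<and>
     (\<forall>\<eta>\<in>test_functions U.
        (\<integral>x. u x * frechet_derivative \<eta> (at x) b \<partial>lebesgue_on U) = - (\<integral>x. v x * \<eta> x \<partial>lebesgue_on U))"

definition has_weak_gradient ::
  "'a::euclidean_space set \<Rightarrow> ('a \<Rightarrow> real) \<Rightarrow> ('a \<Rightarrow> 'a) \<Rightarrow> bool" where
  "has_weak_gradient U u v \<longleftrightarrow> (\<forall>b\<in>Basis. has_weak_partial U b u (\<lambda>x. v x \<bullet> b))"

text \<open>The weak gradient is determined up to null sets; the choice of a representative does
  not influence the integrals below.\<close>

definition weak_gradient :: "'a::euclidean_space set \<Rightarrow> ('a \<Rightarrow> real) \<Rightarrow> 'a \<Rightarrow> 'a" where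
  "weak_gradient U u = (SOME v. has_weak_gradient U u v)"

section \<open>Musielak--Orlicz--Sobolev spaces\<close>

text \<open>Elements of the spaces are functions rather than classes of functions, and only their
  values on \<open>U\<close> matter.\<close>

definition L_phi :: "('a::euclidean_space \<Rightarrow> real \<Rightarrow> ennreal) \<Rightarrow> 'a set \<Rightarrow> ('a \<Rightarrow> real) set" where
  "L_phi \<phi> U = {g \<in> borel_measurable (lebesgue_on U).
     \<exists>k>0. (\<integral>\<^sup>+x. \<phi> x (k * \<bar>g x\<bar>) \<partial>lebesgue_on U) < \<infinity>}"

definition L_phi_norm ::
  "('a::euclidean_space \<Rightarrow> real \<Rightarrow> ennreal) \<Rightarrow> 'a set \<Rightarrow> ('a \<Rightarrow> 'b::real_normed_vector) \<Rightarrow> ennreal" where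
  "L_phi_norm \<phi> U g =
     (INF k\<in>{k. 0 < k \<and> (\<integral>\<^sup>+x. \<phi> x (norm (g x) / k) \<partial>lebesgue_on U) \<le> 1}. ennreal k)"

definition W1_phi :: "('a::euclidean_space \<Rightarrow> real \<Rightarrow> ennreal) \<Rightarrow> 'a set \<Rightarrow> ('a \<Rightarrow> real) set" where
  "W1_phi \<phi> U = {u \<in> L_phi \<phi> U.
     \<exists>v. has_weak_gradient U u v \<and> (\<forall>b\<in>Basis. (\<lambda>x. v x \<bullet> b) \<in> L_phi \<phi> U)}"

definition W1_phi_norm ::
  "('a::euclidean_space \<Rightarrow> real \<Rightarrow> ennreal) \<Rightarrow> 'a set \<Rightarrow> ('a \<Rightarrow> real) \<Rightarrow> ennreal" where
  "W1_phi_norm \<phi> U u = L_phi_norm \<phi> U u + L_phi_norm \<phi> U (weak_gradient U u)"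

definition W1_phi_0 :: "('a::euclidean_space \<Rightarrow> real \<Rightarrow> ennreal) \<Rightarrow> 'a set \<Rightarrow> ('a \<Rightarrow> real) set" where
  "W1_phi_0 \<phi> U = {u \<in> W1_phi \<phi> U.
     \<forall>\<epsilon>>0. \<exists>\<eta>\<in>test_functions U. W1_phi_norm \<phi> U (\<lambda>x. u x - \<eta> x) < \<epsilon>}"

section \<open>Capacity, measure density and fatness\<close>

text \<open>The capacity is meant for open \<open>U\<close> and for \<open>E\<close> with compact closure contained in \<open>U\<close>.\<close>

definition phi_capacity ::
  "('a::euclidean_space \<Rightarrow> real \<Rightarrow> ennreal) \<Rightarrow> 'a set \<Rightarrow> 'a set \<Rightarrow> ennreal" where
  "phi_capacity \<phi> E U =
     (INF w\<in>{w \<in> W1_phi_0 \<phi> U. \<exists>V. open V \<and> E \<subseteq> V \<and> V \<subseteq> U \<and> (\<forall>x\<in>V. w x \<ge> 1)}.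
        \<integral>\<^sup>+x. \<phi> x (norm (weak_gradient U w x)) \<partial>lebesgue_on U)"

definition measure_density :: "'a::euclidean_space set \<Rightarrow> 'a \<Rightarrow> bool" where
  "measure_density \<Omega> x\<^sub>0 \<longleftrightarrow> (\<exists>c R. 0 < c \<and> c < 1 \<and> 0 < R \<and>
     (\<forall>r. 0 < r \<and> r \<le> R \<longrightarrow>
        measure lebesgue (ball x\<^sub>0 r - \<Omega>) \<ge> c * measure lebesgue (ball x\<^sub>0 r)))"

definition complement_locally_fat ::
  "('a::euclidean_space \<Rightarrow> real \<Rightarrow> ennreal) \<Rightarrow> 'a set \<Rightarrow> 'a \<Rightarrow> bool" where
  "complement_locally_fat \<phi> \<Omega> x\<^sub>0 \<longleftrightarrow> (\<exists>c R. 0 < c \<and> c < 1 \<and> 0 < R \<and>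
     (\<forall>r. 0 < r \<and> r \<le> R \<longrightarrow>
        phi_capacity \<phi> (ball x\<^sub>0 r - \<Omega>) (ball x\<^sub>0 (2 * r))
          \<ge> ennreal c * phi_capacity \<phi> (ball x\<^sub>0 r) (ball x\<^sub>0 (2 * r))))"

end

theory Submission
  imports Defs
begin

text \<open>Write \<open>B\<close> for the ball of radius \<open>2 * r\<close> around \<open>x\<^sub>0\<close>, where \<open>r\<close> is small, \<open>E\<close> for the part of the ball
  of radius \<open>r\<close> outside \<open>\<Omega>\<close>, and \<open>\<phi>\<^sup>+\<close>, \<open>\<phi>\<^sup>-\<close> for the supremum and infimum of \<open>\<phi>\<close> over \<open>B\<close>. Up to
  constants that do not depend on \<open>r\<close>, both capacities in the fatness condition turn out to be
  \<open>\<phi>\<^sup>-(1 / r)\<close> times the volume of \<open>B\<close>.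

  The capacity of the full ball is bounded from above by a smooth cutoff whose gradient is at most
  \<open>C / r\<close> (\<open>phi_capacity_ball_le\<close>). This gives \<open>\<phi>\<^sup>+(C / r)\<close> times the volume of \<open>B\<close>. The growth condition
  (aDec) lowers the argument by a constant factor, and then (A1-n) replaces \<open>\<phi>\<^sup>+\<close> by \<open>\<phi>\<^sup>-\<close>.

  The capacity of \<open>E\<close> is bounded from below by the Poincare inequality in the Lebesgue space of
  integrable functions (\<open>poincare_W1_phi_0\<close>): an admissible function is at least \<open>1\<close> on \<open>E\<close>, and \<open>E\<close> fills at
  least a fixed fraction of \<open>B\<close>, so the mean of the norm of its gradient over \<open>B\<close> is at least \<open>2 * s\<close> for some \<open>s\<close>
  comparable to \<open>1 / r\<close>. The quotient \<open>\<phi>(x,t) / t\<close> is \<open>L\<close>-almost increasing, so \<open>\<phi>(x,t)\<close> dominates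
  the affine function \<open>\<phi>\<^sup>-(s) (t - s) / (L s)\<close>; integrating it over \<open>B\<close> leaves \<open>\<phi>\<^sup>-(s) / L\<close> times the
  volume of \<open>B\<close> (\<open>phi_capacity_ge\<close>). Once more (aDec) compares \<open>\<phi>\<^sup>-(s)\<close> with \<open>\<phi>\<^sup>-(1 / r)\<close>.

  Two facts about weak gradients carry the passage between test functions and Sobolev functions:
  smooth functions satisfy the integration by parts formula (\<open>has_weak_partial_if_smooth\<close>), and weak
  gradients are unique almost everywhere (\<open>has_weak_gradient_unique\<close>). The second rests on the
  fundamental lemma of the calculus of variations (\<open>AE_eq_0_if_test_integrals_eq_0\<close>), which is tested
  with explicit smooth bumps on boxes.\<close>

section \<open>Calculus of smooth functions\<close>

lemma Ck_SucI:
  assumes "\<And>x. (f has_derivative f' x) (at x)" and "\<And>b. b \<in> Basis \<Longrightarrow> Ck k (\<lambda>x. f' x b)"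
  shows "Ck (Suc k) f"
proof -
  have "frechet_derivative f (at x) = f' x" for x
    using frechet_derivative_at[OF assms(1)] by simp
  moreover have "f differentiable (at x)" for x
    using assms(1) by (auto simp: differentiable_def)
  ultimately show ?thesis using assms(2) by simp
qed

lemma Ck_SucD:
  assumes "Ck (Suc k) f"
  shows "(f has_derivative frechet_derivative f (at x)) (at x)"
    and "b \<in> Basis \<Longrightarrow> Ck k (\<lambda>x. frechet_derivative f (at x) b)"
  using assms by (auto simp: frechet_derivative_works)

lemma Ck_Suc_imp_Ck: "Ck (Suc k) f \<Longrightarrow> Ck k f"
proof (induction k arbitrary: f)
  case 0
  then show ?case
    by (auto intro!: differentiable_imp_continuous_on simp: differentiable_on_def intro: differentiable_at_withinI)
next
  case (Suc k)
  then show ?case by (metis Ck.simps(2))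
qed

lemma Ck_const: "Ck k (\<lambda>x::'a::euclidean_space. c)"
proof (induction k arbitrary: c)
  case (Suc k)
  show ?case by (rule Ck_SucI[where f' = "\<lambda>x h. 0"]) (use Suc in auto)
qed simp

lemma Ck_inner: "Ck k (\<lambda>x::'a::euclidean_space. x \<bullet> a)"
proof (cases k)
  case (Suc j)
  show ?thesis unfolding Suc
    by (rule Ck_SucI[where f' = "\<lambda>x h. h \<bullet> a"]) (auto intro!: derivative_eq_intros Ck_const)
qed (auto intro!: continuous_intros)

lemma Ck_add: "Ck k f \<Longrightarrow> Ck k g \<Longrightarrow> Ck k (\<lambda>x. f x + g x)"
proof (induction k arbitrary: f g)
  case (Suc k)
  show ?case
  proof (rule Ck_SucI[where f' = "\<lambda>x h. frechet_derivative f (at x) h + frechet_derivative g (at x) h"])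
    show "((\<lambda>x. f x + g x) has_derivative
        (\<lambda>h. frechet_derivative f (at x) h + frechet_derivative g (at x) h)) (at x)" for x
      using Ck_SucD(1) Suc.prems by (intro has_derivative_add)
    show "Ck k (\<lambda>x. frechet_derivative f (at x) b + frechet_derivative g (at x) b)"
      if "b \<in> Basis" for b
      using Ck_SucD(2)[OF Suc.prems(1) that] Ck_SucD(2)[OF Suc.prems(2) that] by (rule Suc.IH)
  qed
qed (auto intro!: continuous_intros)

lemma Ck_mult: "Ck k f \<Longrightarrow> Ck k g \<Longrightarrow> Ck k (\<lambda>x. f x * g x)"
proof (induction k arbitrary: f g)
  case (Suc k)
  show ?case
  proof (rule Ck_SucI[where f' = "\<lambda>x h. f x * frechet_derivative g (at x) h + frechet_derivative f (at x) h * g x"])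
    show "((\<lambda>x. f x * g x) has_derivative
        (\<lambda>h. f x * frechet_derivative g (at x) h + frechet_derivative f (at x) h * g x)) (at x)" for x
      using Ck_SucD(1) Suc.prems by (intro has_derivative_mult)
    show "Ck k (\<lambda>x. f x * frechet_derivative g (at x) b + frechet_derivative f (at x) b * g x)"
      if "b \<in> Basis" for b
      using Ck_SucD(2)[OF Suc.prems(1) that] Ck_SucD(2)[OF Suc.prems(2) that] Suc.IH Ck_Suc_imp_Ck[OF Suc.prems(1)] Ck_Suc_imp_Ck[OF Suc.prems(2)]
      by (intro Ck_add) auto
  qed
qed (auto intro!: continuous_intros)

lemma Ck_prod: "(\<And>i. i \<in> I \<Longrightarrow> Ck k (f i)) \<Longrightarrow> Ck k (\<lambda>x. \<Prod>i\<in>I. f i x)"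
  by (induction I rule: infinite_finite_induct) (auto intro!: Ck_const Ck_mult)

lemma Ck_sum: "(\<And>i. i \<in> I \<Longrightarrow> Ck k (f i)) \<Longrightarrow> Ck k (\<lambda>x. \<Sum>i\<in>I. f i x)"
  by (induction I rule: infinite_finite_induct) (auto intro!: Ck_const Ck_add)

section \<open>A flat function and its compositions\<close>

text \<open>The functions \<open>t\<^sup>-\<^sup>m exp (- 1 / t)\<close>, extended by \<open>0\<close> to \<open>t \<le> 0\<close>. The case \<open>m = 0\<close> is the classical
  smooth function that is not analytic at \<open>0\<close>. The whole family is kept because its linear
  span is closed under differentiation, so that smoothness follows by one induction over all \<open>m\<close>
  at once.\<close>

definition flat :: "nat \<Rightarrow> real \<Rightarrow> real" where
  "flat m t = (if 0 < t then inverse t ^ m * exp (- inverse t) else 0)"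

lemma flat_nonneg: "0 \<le> flat m t" by (simp add: flat_def)

text \<open>One term of the exponential series gives \<open>u\<^sup>k \<le> k! exp u\<close>; apply it to \<open>u = 1 / t\<close>. The case
  \<open>i = 2\<close> gives the derivative at \<open>0\<close>, the case \<open>i = 0\<close> a bound for \<open>flat m\<close>.\<close>

lemma flat_le: "flat m t \<le> fact (m + i) * \<bar>t\<bar> ^ i"
proof (cases "0 < t")
  case True
  define u where "u = inverse t"
  have u: "u > 0" and t: "\<bar>t\<bar> = 1 / u" using True by (simp_all add: u_def field_simps)
  have "(\<Sum>n\<in>{m + i}. u ^ n /\<^sub>R fact n) \<le> exp u"
    unfolding sums_unique[OF exp_converges]
    by (intro sum_le_suminf sums_summable[OF exp_converges]) (use u in auto)
  then have "u ^ (m + i) \<le> fact (m + i) * exp u"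
    by (simp add: field_simps)
  then have "u ^ m * exp (- u) \<le> fact (m + i) * (1 / u) ^ i"
    using u by (simp add: field_simps power_add exp_minus)
  moreover have "flat m t = u ^ m * exp (- u)"
    using True by (simp add: flat_def u_def)
  ultimately show ?thesis
    by (simp add: t)
qed (simp add: flat_def)

lemma flat_has_real_derivative:
  "(flat m has_real_derivative flat (m + 2) t - m * flat (m + 1) t) (at t)"
proof (cases "t = 0")
  case True
  have "((\<lambda>h. flat m h / h) \<longlongrightarrow> 0) (at 0)"
  proof (rule Lim_null_comparison)
    show "\<forall>\<^sub>F h in at 0. norm (flat m h / h) \<le> fact (m + 2) * \<bar>h\<bar>"
    proof (intro eventually_at_filter[THEN iffD2] always_eventually allI impI)
      fix h :: real assume "h \<noteq> 0"
      then have "flat m h / \<bar>h\<bar> \<le> fact (m + 2) * \<bar>h\<bar> ^ 2 / \<bar>h\<bar>"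
        by (intro divide_right_mono flat_le) auto
      also have "\<dots> = fact (m + 2) * \<bar>h\<bar>"
        using \<open>h \<noteq> 0\<close> by (simp add: abs_if power2_eq_square)
      finally show "norm (flat m h / h) \<le> fact (m + 2) * \<bar>h\<bar>"
        using \<open>h \<noteq> 0\<close> flat_nonneg[of m h] by (simp add: abs_divide del: fact_Suc)
    qed
    show "((\<lambda>h::real. fact (m + 2) * \<bar>h\<bar>) \<longlongrightarrow> 0) (at 0)"
      by (auto intro!: tendsto_eq_intros)
  qed
  then show ?thesis by (simp add: True DERIV_def flat_def)
next
  case False
  then consider "t > 0" | "t < 0" by linarith
  then show ?thesis
  proof cases
    case 1
    have "((\<lambda>t. inverse t ^ m * exp (- inverse t)) has_real_derivative
        inverse t ^ m * (exp (- inverse t) * (inverse t)\<^sup>2)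
        + (real m * (inverse t ^ (m - Suc 0) * - ((inverse t)\<^sup>2))) * exp (- inverse t)) (at t)"
      using 1 by (auto intro!: derivative_eq_intros simp: power2_eq_square)
    also have "inverse t ^ m * (exp (- inverse t) * (inverse t)\<^sup>2)
        + (real m * (inverse t ^ (m - Suc 0) * - ((inverse t)\<^sup>2))) * exp (- inverse t)
        = flat (m + 2) t - m * flat (m + 1) t"
      using 1 by (cases m) (simp_all add: flat_def power2_eq_square algebra_simps)
    finally have "((\<lambda>t. inverse t ^ m * exp (- inverse t)) has_real_derivative
        flat (m + 2) t - m * flat (m + 1) t) (at t)" .
    then show ?thesis
      by (rule has_field_derivative_transform_within_open[of _ _ _ "{0<..}"]) (use 1 in \<open>auto simp: flat_def\<close>)
  next
    case 2
    have "((\<lambda>t. 0) has_real_derivative flat (m + 2) t - m * flat (m + 1) t) (at t)"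
      using 2 by (auto simp: flat_def)
    then show ?thesis
      by (rule has_field_derivative_transform_within_open[of _ _ _ "{..<0}"]) (use 2 in \<open>auto simp: flat_def\<close>)
  qed
qed

text \<open>The partial derivatives of \<open>flat m \<circ> p\<close> are combinations of \<open>flat (m + 1) \<circ> p\<close> and
  \<open>flat (m + 2) \<circ> p\<close> with smooth coefficients, so the induction on the order has to run over all
  \<open>m\<close> simultaneously.\<close>

lemma Ck_flat_comp:
  fixes p :: "'a::euclidean_space \<Rightarrow> real"
  assumes "\<And>k. Ck k p"
  shows "Ck k (\<lambda>x. flat m (p x))"
proof (induction k arbitrary: m)
  case 0
  have "continuous_on UNIV p" using assms[of 0] by simp
  moreover have "continuous_on UNIV (flat m)"
    by (rule DERIV_continuous_on[OF has_field_derivative_at_within[OF flat_has_real_derivative]])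
  ultimately show ?case
    by (auto intro: continuous_on_compose2)
next
  case (Suc k)
  have p: "(p has_derivative frechet_derivative p (at x)) (at x)" for x
    using Ck_SucD(1) assms by blast
  show ?case
  proof (rule Ck_SucI)
    show "((\<lambda>x. flat m (p x)) has_derivative
       (\<lambda>h. frechet_derivative p (at x) h * (flat (m + 2) (p x) + (- m) * flat (m + 1) (p x)))) (at x)" for x
      using has_derivative_compose[OF p has_field_derivative_imp_has_derivative[OF flat_has_real_derivative], of m x]
      by (simp add: mult.commute)
    show "Ck k (\<lambda>x. frechet_derivative p (at x) b * (flat (m + 2) (p x) + (- m) * flat (m + 1) (p x)))"
      if "b \<in> Basis" for b
      using Ck_SucD(2)[OF assms that] Suc.IH by (intro Ck_mult Ck_add Ck_const) auto
  qed
qed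

section \<open>Test functions\<close>

lemma test_functionsI:
  assumes "\<And>k. Ck k \<eta>" "{x. \<eta> x \<noteq> 0} \<subseteq> K" "compact K" "K \<subseteq> U"
  shows "\<eta> \<in> test_functions U"
proof -
  have "closure {x. \<eta> x \<noteq> 0} \<subseteq> K"
    by (intro closure_minimal assms compact_imp_closed)
  moreover from this have "compact (closure {x. \<eta> x \<noteq> 0})"
    using compact_Int_closed[OF \<open>compact K\<close> closed_closure, of "{x. \<eta> x \<noteq> 0}"] by (simp add: Int_absorb1)
  ultimately show ?thesis
    unfolding test_functions_def using assms(1,4) by blast
qed

lemma test_functionsE:
  assumes "\<eta> \<in> test_functions U"
  obtains K where "compact K" "K \<subseteq> U" "\<forall>x. x \<notin> K \<longrightarrow> \<eta> x = 0"
    "\<forall>x b. x \<notin> K \<longrightarrow> frechet_derivative \<eta> (at x) b = 0"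
proof -
  define K where "K = closure {x. \<eta> x \<noteq> 0}"
  have K: "compact K" "K \<subseteq> U"
    using assms by (auto simp: test_functions_def K_def)
  have 0: "\<eta> x = 0" if "x \<notin> K" for x
    using that closure_subset[of "{x. \<eta> x \<noteq> 0}"] unfolding K_def by blast
  have "(\<eta> has_derivative (\<lambda>h. 0)) (at x)" if "x \<notin> K" for x
    by (rule has_derivative_transform_within_open[where f="\<lambda>x. 0" and s = "- K"])
      (use that 0 K in \<open>auto simp: open_Compl compact_imp_closed\<close>)
  from frechet_derivative_at[OF this] have "frechet_derivative \<eta> (at x) b = 0" if "x \<notin> K" for x b
    using that by metis
  with K 0 show thesis using that by blast
qed

lemma test_function_Ck: "\<eta> \<in> test_functions U \<Longrightarrow> Ck k \<eta>"
  by (simp add: test_functions_def)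

lemma test_function_has_derivative:
  "\<eta> \<in> test_functions U \<Longrightarrow> (\<eta> has_derivative frechet_derivative \<eta> (at x)) (at x)"
  by (rule Ck_SucD(1)[OF test_function_Ck])

lemma test_function_has_line_derivative:
  assumes "\<eta> \<in> test_functions U"
  shows "((\<lambda>t. \<eta> (x + t *\<^sub>R b)) has_real_derivative frechet_derivative \<eta> (at (x + t *\<^sub>R b)) b) (at t)"
proof -
  let ?D = "frechet_derivative \<eta> (at (x + t *\<^sub>R b))"
  have D: "(\<eta> has_derivative ?D) (at (x + t *\<^sub>R b))"
    by (rule test_function_has_derivative[OF assms])
  have "((\<lambda>t. x + t *\<^sub>R b) has_derivative (\<lambda>h. h *\<^sub>R b)) (at t)"
    by (auto intro!: derivative_eq_intros)
  from has_derivative_compose[OF this D]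
  have "((\<lambda>t. \<eta> (x + t *\<^sub>R b)) has_derivative (\<lambda>h. ?D (h *\<^sub>R b))) (at t)" .
  also have "(\<lambda>h. ?D (h *\<^sub>R b)) = (\<lambda>h. ?D b * h)"
    using linear_cmul[OF has_derivative_linear[OF D]] by (simp add: mult.commute)
  finally show ?thesis
    by (simp add: has_field_derivative_def)
qed

lemma test_function_continuous: "\<eta> \<in> test_functions U \<Longrightarrow> continuous_on S \<eta>"
  using test_function_Ck[of \<eta> U 0] continuous_on_subset by auto

lemma test_function_partial_continuous:
  "\<eta> \<in> test_functions U \<Longrightarrow> b \<in> Basis \<Longrightarrow> continuous_on S (\<lambda>x. frechet_derivative \<eta> (at x) b)"
  using Ck_SucD(2)[OF test_function_Ck, of \<eta> U b 0] continuous_on_subset by auto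

lemma test_functions_mult:
  assumes "\<And>k. Ck k u" "\<eta> \<in> test_functions U"
  shows "(\<lambda>x. u x * \<eta> x) \<in> test_functions U"
proof -
  obtain K where "compact K" "K \<subseteq> U" "\<forall>x. x \<notin> K \<longrightarrow> \<eta> x = 0"
    "\<forall>x b. x \<notin> K \<longrightarrow> frechet_derivative \<eta> (at x) b = 0"
    by (rule test_functionsE[OF assms(2)])
  then show ?thesis
    by (intro test_functionsI[of _ K] Ck_mult assms test_function_Ck[OF assms(2)]) auto
qed

text \<open>Each factor \<open>flat 0 (j t)\<close> increases to the indicator of \<open>t > 0\<close>, so these test functions
  converge to the indicator of the open box. The scaling is by \<open>Suc j\<close> so that it never vanishes.\<close>

definition box_bump :: "'a::euclidean_space \<Rightarrow> 'a \<Rightarrow> nat \<Rightarrow> 'a \<Rightarrow> real" where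
  "box_bump a c j x = (\<Prod>b\<in>Basis. flat 0 (Suc j * (x \<bullet> b - a \<bullet> b)) * flat 0 (Suc j * (c \<bullet> b - x \<bullet> b)))"

lemma flat_0_le_1: "flat 0 t \<le> 1"
  by (simp add: flat_def)

lemma box_bump_nonneg: "0 \<le> box_bump a c j x"
  unfolding box_bump_def by (intro prod_nonneg mult_nonneg_nonneg flat_nonneg)

lemma box_bump_le_1: "box_bump a c j x \<le> 1"
  unfolding box_bump_def
  by (intro prod_le_1 conjI mult_le_one mult_nonneg_nonneg flat_nonneg flat_0_le_1)

lemma box_bump_eq_0: "x \<notin> box a c \<Longrightarrow> box_bump a c j x = 0"
  unfolding box_bump_def
  by (auto simp: box_def flat_def zero_less_mult_iff intro!: prod_zero bexI)

lemma box_bump_test_function: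
  assumes "cbox a c \<subseteq> U"
  shows "box_bump a c j \<in> test_functions U"
proof (rule test_functionsI[of _ "cbox a c"])
  have "box_bump a c j = (\<lambda>x. \<Prod>b\<in>Basis. flat 0 (real (Suc j) * (x \<bullet> b + - (a \<bullet> b)))
      * flat 0 (real (Suc j) * (c \<bullet> b + (- 1) * (x \<bullet> b))))"
    by (auto simp: box_bump_def fun_eq_iff)
  then show "Ck k (box_bump a c j)" for k
    by (simp only:) (intro Ck_prod Ck_mult Ck_flat_comp Ck_add Ck_const Ck_inner)
  show "{x. box_bump a c j x \<noteq> 0} \<subseteq> cbox a c"
    using box_bump_eq_0 box_subset_cbox by blast
qed (use assms in auto)

lemma tendsto_flat_0:
  fixes t :: real
  shows "(\<lambda>j. flat 0 (Suc j * t)) \<longlonglongrightarrow> (if 0 < t then 1 else 0)"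
proof (cases "0 < t")
  case True
  have "(\<lambda>j. 1 / real (Suc j)) \<longlonglongrightarrow> 0" using LIMSEQ_inverse_real_of_nat by (simp add: inverse_eq_divide)
  then have "(\<lambda>j. exp (- (1 / real (Suc j)) / t)) \<longlonglongrightarrow> exp (- 0 / t)"
    by (intro tendsto_intros) (use True in auto)
  moreover have "flat 0 (Suc j * t) = exp (- (1 / real (Suc j)) / t)" for j
    using True by (simp only: flat_def zero_less_mult_iff) (simp add: divide_inverse)
  ultimately show ?thesis using True by simp
next
  case False
  then have "flat 0 (Suc j * t) = 0" for j
    by (auto simp: flat_def zero_less_mult_iff)
  then show ?thesis using False by simp
qed

lemma box_bump_tendsto: "(\<lambda>j. box_bump a c j x) \<longlonglongrightarrow> indicator (box a c) x"
proof -
  have "(\<Prod>b\<in>Basis. (if 0 < x \<bullet> b - a \<bullet> b then 1 else 0) * (if 0 < c \<bullet> b - x \<bullet> b then 1 else 0))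
      = (indicator (box a c) x :: real)"
    by (auto simp: indicator_def box_def intro!: prod.neutral prod_zero)
  moreover have "(\<lambda>j. box_bump a c j x) \<longlonglongrightarrow>
    (\<Prod>b\<in>Basis. (if 0 < x \<bullet> b - a \<bullet> b then 1 else 0) * (if 0 < c \<bullet> b - x \<bullet> b then 1 else 0))"
    unfolding box_bump_def by (intro tendsto_intros tendsto_flat_0)
  ultimately show ?thesis by simp
qed

definition gradient :: "('a::euclidean_space \<Rightarrow> real) \<Rightarrow> 'a \<Rightarrow> 'a" where
  "gradient f x = (\<Sum>b\<in>Basis. frechet_derivative f (at x) b *\<^sub>R b)"

lemma gradient_inner_Basis: "b \<in> Basis \<Longrightarrow> gradient f x \<bullet> b = frechet_derivative f (at x) b"
  by (simp add: gradient_def inner_sum_left inner_Basis if_distrib sum.delta cong: if_cong)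

lemma gradient_eqI: "(f has_derivative (\<lambda>h. g \<bullet> h)) (at x) \<Longrightarrow> gradient f x = g"
  using frechet_derivative_at[of f "\<lambda>h. g \<bullet> h" x]
  by (metis (no_types, lifting) euclidean_representation gradient_def sum.cong)

text \<open>The cutoff is supported in the ball of radius \<open>sqrt 3 * r < 2 * r\<close>. For \<open>norm (x - z) < r\<close> the
  argument of \<open>flat 0\<close> exceeds \<open>2 / 3\<close>, where its value exceeds \<open>exp (- 3 / 2)\<close>; this explains
  the factor \<open>exp (3 / 2)\<close>.\<close>

definition radial_cutoff :: "'a::euclidean_space \<Rightarrow> real \<Rightarrow> 'a \<Rightarrow> real" where
  "radial_cutoff z r x = exp (3/2) * flat 0 (1 - (norm (x - z))\<^sup>2 / (3 * r\<^sup>2))"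

lemma norm_le_if_flat_nonzero:
  assumes "flat m (1 - (norm y)\<^sup>2 / (3 * r\<^sup>2)) \<noteq> 0" "0 < r"
  shows "norm y \<le> sqrt 3 * r"
proof -
  have "(norm y)\<^sup>2 \<le> 3 * r\<^sup>2"
    using assms by (auto simp: flat_def field_simps split: if_splits)
  also have "\<dots> = (sqrt 3 * r)\<^sup>2" by (simp add: power_mult_distrib)
  finally show ?thesis
    using assms by (auto intro: power2_le_imp_le)
qed

lemma radial_cutoff_test_function:
  assumes "0 < r"
  shows "radial_cutoff z r \<in> test_functions (ball z (2 * r))"
proof (rule test_functionsI[of _ "cball z (sqrt 3 * r)"])
  have "(norm (x - z))\<^sup>2 = (\<Sum>b\<in>Basis. (x \<bullet> b + - (z \<bullet> b)) * (x \<bullet> b + - (z \<bullet> b)))" for x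
    by (subst power2_norm_eq_inner, subst euclidean_inner) (simp add: inner_diff_left)
  then have "radial_cutoff z r = (\<lambda>x. exp (3/2) * flat 0 (1 + (- 1 / (3 * r\<^sup>2)) *
      (\<Sum>b\<in>Basis. (x \<bullet> b + - (z \<bullet> b)) * (x \<bullet> b + - (z \<bullet> b)))))"
    by (simp add: radial_cutoff_def fun_eq_iff)
  then show "Ck k (radial_cutoff z r)" for k
    by (simp only:) (intro Ck_sum Ck_mult Ck_flat_comp Ck_add Ck_const Ck_inner)
  show "{x. radial_cutoff z r x \<noteq> 0} \<subseteq> cball z (sqrt 3 * r)"
    using norm_le_if_flat_nonzero[OF _ assms] by (auto simp: radial_cutoff_def dist_norm norm_minus_commute)
  have "sqrt 3 < 2" by (rule real_less_lsqrt) auto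
  then have "sqrt 3 * r < 2 * r"
    using assms by simp
  then show "cball z (sqrt 3 * r) \<subseteq> ball z (2 * r)"
    by (meson le_less_trans mem_ball mem_cball subsetI)
qed auto

lemma radial_cutoff_ge_1:
  assumes "x \<in> ball z r"
  shows "1 \<le> radial_cutoff z r x"
proof -
  define s where "s = 1 - (norm (x - z))\<^sup>2 / (3 * r\<^sup>2)"
  have n: "norm (x - z) < r" using assms by (simp add: dist_norm norm_minus_commute)
  then have "0 < r" by (meson norm_ge_zero le_less_trans)
  moreover have "(norm (x - z))\<^sup>2 \<le> r\<^sup>2"
    using n by (intro power_mono) auto
  ultimately have "2 / 3 \<le> s" by (simp add: s_def field_simps)
  then have "flat 0 s = exp (- inverse s)"
    by (simp add: flat_def)
  then have "exp (3/2) * flat 0 s = exp (3/2 - inverse s)"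
    by (simp add: exp_add[symmetric])
  moreover have "inverse s \<le> 3/2"
    using le_imp_inverse_le[OF \<open>2 / 3 \<le> s\<close>] by simp
  ultimately show ?thesis
    by (simp add: radial_cutoff_def s_def)
qed

lemma norm_gradient_radial_cutoff_le:
  assumes "0 < r"
  shows "norm (gradient (radial_cutoff z r) x) \<le> 3 * exp (3/2) / r"
proof -
  define s where "s = 1 - (norm (x - z))\<^sup>2 / (3 * r\<^sup>2)"
  define c where "c = exp (3/2) * flat 2 s * 2 / (3 * r\<^sup>2)"
  have "((\<lambda>x. 1 - (1 / (3 * r\<^sup>2)) * ((x - z) \<bullet> (x - z))) has_derivative
      (\<lambda>h. - ((1 / (3 * r\<^sup>2)) * (2 * ((x - z) \<bullet> h))))) (at x)"
    by (rule derivative_eq_intros refl | simp add: inner_commute)+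
  then have "((\<lambda>x. 1 - (x - z) \<bullet> (x - z) / (3 * r\<^sup>2)) has_derivative
      (\<lambda>h. - (2 * ((x - z) \<bullet> h) / (3 * r\<^sup>2)))) (at x)"
    by simp
  from has_derivative_compose[OF this has_field_derivative_imp_has_derivative[OF flat_has_real_derivative[of 0]]]
  have "((\<lambda>x. exp (3/2) * flat 0 (1 - (x - z) \<bullet> (x - z) / (3 * r\<^sup>2))) has_derivative
      (\<lambda>h. exp (3/2) * (flat 2 s * - (2 * ((x - z) \<bullet> h) / (3 * r\<^sup>2))))) (at x)"
    by (intro has_derivative_mult_right) (simp add: s_def power2_norm_eq_inner flip: numeral_2_eq_2)
  then have "(radial_cutoff z r has_derivative (\<lambda>h. (- c *\<^sub>R (x - z)) \<bullet> h)) (at x)"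
    by (simp add: radial_cutoff_def[abs_def] power2_norm_eq_inner c_def mult_ac)
  then have "gradient (radial_cutoff z r) x = - c *\<^sub>R (x - z)"
    by (rule gradient_eqI)
  then have "norm (gradient (radial_cutoff z r) x) = \<bar>c\<bar> * norm (x - z)"
    by simp
  also have "\<dots> \<le> 3 * exp (3/2) / r"
  proof (cases "flat 2 s = 0")
    case False
    have "sqrt 3 < 2" by (rule real_less_lsqrt) auto
    then have "sqrt 3 * r \<le> 2 * r"
      using assms by simp
    then have "norm (x - z) \<le> 2 * r"
      using norm_le_if_flat_nonzero[OF _ assms] False unfolding s_def by (meson order_trans)
    moreover have "flat 2 s \<le> 2"
      using flat_le[of 2 s 0] by (simp add: fact_numeral)
    then have "\<bar>c\<bar> \<le> exp (3/2) * 2 * 2 / (3 * r\<^sup>2)"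
      using flat_nonneg[of 2 s] assms by (simp add: c_def divide_right_mono)
    ultimately have "\<bar>c\<bar> * norm (x - z) \<le> exp (3/2) * 2 * 2 / (3 * r\<^sup>2) * (2 * r)"
      by (intro mult_mono) auto
    also have "\<dots> \<le> 3 * exp (3/2) / r"
      using assms by (simp add: field_simps power2_eq_square)
    finally show ?thesis .
  qed (use assms in \<open>auto simp: c_def\<close>)
  finally show ?thesis .
qed

section \<open>The fundamental lemma of the calculus of variations\<close>

text \<open>The boxes form an intersection-stable generator of the Borel sets, and the sets over which \<open>f\<close>
  integrates to \<open>0\<close> are closed under complements and disjoint unions.\<close>

lemma set_integral_borel_eq_0:
  fixes f :: "'a::euclidean_space \<Rightarrow> real"
  assumes f: "integrable lborel f" and box: "\<And>a c. (\<integral>x\<in>box a c. f x \<partial>lborel) = 0"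
    and A: "A \<in> sets borel"
  shows "(\<integral>x\<in>A. f x \<partial>lborel) = 0"
proof -
  let ?E = "range (\<lambda>(a, c). box a c :: 'a set)"
  have set_int: "set_integrable lborel B f" if "B \<in> sets borel" for B
    unfolding set_integrable_def using that f by (intro integrable_mult_indicator) auto
  have sets: "sets borel = sigma_sets UNIV ?E"
    by (subst borel_eq_box) (simp add: sets_measure_of)
  have "Int_stable ?E"
    by (auto simp: Int_stable_def box_Int_box)
  moreover have "?E \<subseteq> Pow UNIV" by simp
  ultimately show ?thesis
    using A unfolding sets
  proof (induction rule: sigma_sets_induct_disjoint)
    case (compl B)
    have *: "B \<in> sets borel" using compl(1) sets by simp
    have "(\<lambda>n. \<integral>x\<in>box (- real n *\<^sub>R One) (real n *\<^sub>R One). f x \<partial>lborel)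
        \<longlonglongrightarrow> (\<integral>x\<in>(\<Union>n. box (- real n *\<^sub>R One) (real n *\<^sub>R One)). f x \<partial>lborel)"
    proof (rule set_integral_cont_up)
      show "incseq (\<lambda>n. box (- real n *\<^sub>R One) (real n *\<^sub>R One :: 'a))"
        by (auto simp: incseq_def box_def intro: order.strict_trans1 order.strict_trans2)
      show "set_integrable lborel (\<Union>n. box (- real n *\<^sub>R One) (real n *\<^sub>R One)) f"
        by (rule set_int) (auto intro: borel_open)
    qed (auto intro: borel_open)
    then have "(\<integral>x\<in>UNIV. f x \<partial>lborel) = 0"
      using LIMSEQ_unique[OF _ tendsto_const] by (simp add: box UN_box_eq_UNIV)
    moreover have "(\<integral>x\<in>UNIV. f x \<partial>lborel) = (\<integral>x\<in>B. f x \<partial>lborel) + (\<integral>x\<in>UNIV - B. f x \<partial>lborel)"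
      using set_integral_Un[OF _ set_int set_int, of B "UNIV - B"] * by (simp add: Un_absorb1)
    ultimately show ?case using compl.IH by simp
  next
    case (union B)
    then have *: "range B \<subseteq> sets borel" by (simp only: sets)
    have "(\<integral>x\<in>(\<Union>i. B i). f x \<partial>lborel) = (\<Sum>i. \<integral>x\<in>B i. f x \<partial>lborel)"
      using union * by (intro lebesgue_integral_countable_add set_int) (auto simp: disjoint_family_on_def)
    then show ?case using union by simp
  qed (use box in \<open>auto simp: set_lebesgue_integral_def\<close>)
qed

text \<open>The Borel measurable case transfers through a Borel representative of \<open>f\<close>.\<close>

lemma AE_eq_0_if_box_integrals_eq_0:
  fixes f :: "'a::euclidean_space \<Rightarrow> real"
  assumes f: "integrable lebesgue f"
    and box: "\<And>a c. (\<integral>x. indicator (box a c) x * f x \<partial>lebesgue) = 0"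
  shows "AE x in lebesgue. f x = 0"
proof -
  have "f \<in> borel_measurable (completion lborel)" using f by auto
  then obtain g where g: "g \<in> borel_measurable lborel" and "AE x in lborel. f x = g x"
    using completion_ex_borel_measurable_real by blast
  then have AE: "AE x in lebesgue. f x = g x" by (intro AE_completion)
  have [measurable]: "g \<in> borel_measurable borel" using g by simp
  have "integrable lebesgue g"
    using f AE by (subst integrable_cong_AE[of _ _ f]) (auto simp: measurable_completion eq_commute)
  then have "integrable lborel g" by (simp add: integrable_completion)
  moreover have "(\<integral>x\<in>box a c. g x \<partial>lborel) = 0" for a c
  proof -
    have "(\<integral>x\<in>box a c. g x \<partial>lborel) = (\<integral>x. indicator (box a c) x * g x \<partial>lebesgue)"
      unfolding set_lebesgue_integral_def by (subst integral_completion) auto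
    also have "\<dots> = (\<integral>x. indicator (box a c) x * f x \<partial>lebesgue)"
      using AE f by (intro integral_cong_AE borel_measurable_times) (auto simp: measurable_completion)
    finally show ?thesis using box by simp
  qed
  ultimately have "AE x in lborel. g x = 0"
    by (intro density_unique_real[of _ g "\<lambda>_. 0"]) (auto intro: set_integral_borel_eq_0)
  then have "AE x in lebesgue. g x = 0" by (rule AE_completion)
  with AE show ?thesis by eventually_elim simp
qed

lemma continuous_imp_measurable_lebesgue:
  fixes f :: "'a::euclidean_space \<Rightarrow> 'b::euclidean_space"
  assumes "continuous_on UNIV f"
  shows "f \<in> borel_measurable lebesgue"
  using continuous_imp_measurable_on_sets_lebesgue[OF assms] by (simp add: lebesgue_on_UNIV_eq)

lemma locally_integrable_on_mult:
  assumes "locally_integrable_on u U" "open U" "compact K" "K \<subseteq> U"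
    and "continuous_on UNIV g" "\<And>x. x \<notin> K \<Longrightarrow> g x = 0"
  shows "integrable (lebesgue_on U) (\<lambda>x. u x * g x)"
proof -
  have "bounded (g ` K)"
    using assms by (meson compact_continuous_image compact_imp_bounded continuous_on_subset subset_UNIV)
  moreover have "g \<in> borel_measurable (lebesgue_on K)"
    using assms by (meson compact_imp_closed continuous_imp_measurable_on_sets_lebesgue continuous_on_subset lebesgue_closedin subset_UNIV lmeasurable_compact fmeasurableD)
  ultimately have "(\<lambda>x. g x * u x) absolutely_integrable_on K"
    using assms(1,3,4) by (intro absolutely_integrable_bounded_measurable_product[of "(*)"] bilinear_times)
      (auto simp: locally_integrable_on_def intro: lmeasurable_compact fmeasurableD)
  then have "integrable lebesgue (\<lambda>x. indicator K x *\<^sub>R (g x * u x))"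
    by (simp add: set_integrable_def)
  also have "(\<lambda>x. indicator K x *\<^sub>R (g x * u x)) = (\<lambda>x. indicator U x *\<^sub>R (u x * g x))"
    using assms(4,6) by (auto simp: fun_eq_iff indicator_def)
  finally show ?thesis
    using assms(2) by (simp add: integrable_restrict_space)
qed

text \<open>The bumps turn vanishing integrals against test functions into vanishing integrals over the
  boxes whose closure lies in \<open>U\<close>, by dominated convergence; countably many such boxes cover \<open>U\<close> up
  to their faces, which are null sets.\<close>

lemma AE_eq_0_if_test_integrals_eq_0:
  fixes v :: "'a::euclidean_space \<Rightarrow> real"
  assumes "open U" and v: "locally_integrable_on v U"
    and test: "\<And>\<eta>. \<eta> \<in> test_functions U \<Longrightarrow> (\<integral>x. v x * \<eta> x \<partial>lebesgue_on U) = 0"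
  shows "AE x in lebesgue_on U. v x = 0"
proof -
  have box: "AE x in lebesgue. indicator (box a c) x * v x = 0" if sub: "cbox a c \<subseteq> U" for a c
  proof (rule AE_eq_0_if_box_integrals_eq_0)
    have int: "integrable lebesgue (\<lambda>x. indicator (box a' c') x * v x)"
      if "cbox a' c' \<subseteq> U" for a' c'
    proof -
      have "v absolutely_integrable_on cbox a' c'"
        using v that by (auto simp: locally_integrable_on_def)
      then have "v absolutely_integrable_on box a' c'"
        by (rule set_integrable_subset) (auto simp: box_subset_cbox)
      then show ?thesis by (simp add: set_integrable_def)
    qed
    show "integrable lebesgue (\<lambda>x. indicator (box a c) x * v x)"
      using sub by (rule int)
    fix a' c' :: 'a
    obtain a'' c'' where ac: "box a' c' \<inter> box a c = box a'' c''"
      by (auto simp: box_Int_box)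
    show "(\<integral>x. indicator (box a' c') x * (indicator (box a c) x * v x) \<partial>lebesgue) = 0"
    proof (cases "box a'' c'' = {}")
      case True
      with ac have *: "indicator (box a' c') x * (indicator (box a c) x * v x) = 0" for x
        by (auto simp: indicator_def)
      show ?thesis by (simp only: *) simp
    next
      case False
      then have "cbox a'' c'' \<subseteq> cbox a c"
        using ac box_subset_cbox[of a c] closure_box[of a'' c''] closure_minimal[OF _ closed_cbox, of "box a'' c''" a c]
        by blast
      with sub have sub': "cbox a'' c'' \<subseteq> U" by blast
      have "(\<lambda>j. \<integral>x. indicator (box a'' c'') x * v x * box_bump a'' c'' j x \<partial>lebesgue)
          \<longlonglongrightarrow> (\<integral>x. indicator (box a'' c'') x * v x * indicator (box a'' c'') x \<partial>lebesgue)"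
      proof (rule integral_dominated_convergence)
        show "integrable lebesgue (\<lambda>x. \<bar>indicator (box a'' c'') x * v x\<bar>)"
          using int[OF sub'] by (rule integrable_abs)
        have "continuous_on UNIV (box_bump a'' c'' j)" for j
          by (rule test_function_continuous[OF box_bump_test_function[OF order_refl]])
        then have "box_bump a'' c'' j \<in> borel_measurable lebesgue" for j
          by (rule continuous_imp_measurable_lebesgue)
        then show "(\<lambda>x. indicator (box a'' c'') x * v x * box_bump a'' c'' j x) \<in> borel_measurable lebesgue" for j
          by (rule borel_measurable_times[OF borel_measurable_integrable[OF int[OF sub']]])
        show "(\<lambda>x. indicator (box a'' c'') x * v x * indicator (box a'' c'') x) \<in> borel_measurable lebesgue"
          by (rule borel_measurable_times[OF borel_measurable_integrable[OF int[OF sub']]])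
            (auto intro!: borel_measurable_indicator)
      qed (auto intro!: tendsto_intros box_bump_tendsto AE_I2 mult_left_le simp: abs_mult box_bump_nonneg box_bump_le_1)
      moreover have "(\<integral>x. indicator (box a'' c'') x * v x * box_bump a'' c'' j x \<partial>lebesgue) = 0" for j
      proof -
        have *: "indicator (box a'' c'') x * v x * box_bump a'' c'' j x
            = indicator U x *\<^sub>R (v x * box_bump a'' c'' j x)" for x
          using sub' box_subset_cbox[of a'' c''] by (auto simp: indicator_def box_bump_eq_0)
        show ?thesis
          unfolding * using test[OF box_bump_test_function[OF sub']] \<open>open U\<close> by (simp add: integral_restrict_space)
      qed
      ultimately have "(\<integral>x. indicator (box a'' c'') x * v x * indicator (box a'' c'') x \<partial>lebesgue) = 0"
        using LIMSEQ_unique[OF _ tendsto_const] by simp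
      moreover have "indicator (box a'' c'') x * v x * indicator (box a'' c'') x
          = indicator (box a' c') x * (indicator (box a c) x * v x)" for x
        by (auto simp flip: ac simp: indicator_def)
      ultimately show ?thesis by simp
    qed
  qed
  obtain \<D> :: "'a set set" where \<D>: "countable \<D>" "\<And>X. X \<in> \<D> \<Longrightarrow> \<exists>a b. X = cbox a b" "\<Union>\<D> = U"
    using open_countable_Union_open_cbox[OF \<open>open U\<close>] by metis
  have "AE x in lebesgue. \<forall>X\<in>\<D>. x \<in> X \<longrightarrow> v x = 0"
  proof (subst AE_ball_countable[OF \<D>(1)], intro ballI)
    fix X assume "X \<in> \<D>"
    then obtain a c where "X = cbox a c" "cbox a c \<subseteq> U" using \<D> by blast
    moreover have "AE x in lebesgue. x \<notin> cbox a c - box a c"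
      using negligible_frontier_interval[of a c] by (intro AE_not_in) (simp add: negligible_iff_null_sets)
    ultimately show "AE x in lebesgue. x \<in> X \<longrightarrow> v x = 0"
      using box[of a c] by (auto elim!: eventually_elim2 simp: indicator_def)
  qed
  then have "AE x in lebesgue. x \<in> U \<longrightarrow> v x = 0"
    by eventually_elim (use \<D>(3) in blast)
  then show ?thesis
    using \<open>open U\<close> by (subst AE_restrict_space_iff) auto
qed

section \<open>Integration by parts and the Poincare inequality for test functions\<close>

text \<open>The integral of \<open>f\<close> is invariant under translation, so all difference quotients integrate to \<open>0\<close>;
  they are bounded, have supports in a common ball and converge to the partial derivative.\<close>

lemma integral_partial_test_function_eq_0:
  fixes f :: "'a::euclidean_space \<Rightarrow> real"
  assumes f: "f \<in> test_functions U" and b: "b \<in> Basis"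
  shows "(\<integral>x. frechet_derivative f (at x) b \<partial>lborel) = 0"
proof -
  let ?D = "\<lambda>x. frechet_derivative f (at x) b"
  obtain K where K: "compact K" "K \<subseteq> U" "\<forall>x. x \<notin> K \<longrightarrow> f x = 0"
    "\<forall>x b. x \<notin> K \<longrightarrow> frechet_derivative f (at x) b = 0"
    by (rule test_functionsE[OF f])
  obtain R where R: "K \<subseteq> cball 0 R"
    using compact_imp_bounded[OF K(1)] by (auto simp: bounded_pos subset_eq)
  have cD: "continuous_on UNIV ?D" and cf: "continuous_on UNIV f"
    using f b by (auto intro: test_function_partial_continuous test_function_continuous)
  have [measurable]: "f \<in> borel_measurable borel" "?D \<in> borel_measurable borel"
    using cf cD by (auto intro: borel_measurable_continuous_onI)
  obtain M where M: "\<And>x. \<bar>?D x\<bar> \<le> M" 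
  proof -
    have "bounded (?D ` K)"
      using cD K(1) by (meson compact_continuous_image compact_imp_bounded continuous_on_subset subset_UNIV)
    then obtain M where "\<And>x. x \<in> K \<Longrightarrow> \<bar>?D x\<bar> \<le> M" "0 < M"
      unfolding bounded_pos by auto
    then show thesis using K(4) that[of M] by (metis abs_zero less_imp_le)
  qed
  then have "0 \<le> M" by (meson abs_ge_zero order_trans)
  have line: "((\<lambda>t. f (x + t *\<^sub>R b)) has_real_derivative ?D (x + t *\<^sub>R b)) (at t)" for x t
    by (rule test_function_has_line_derivative[OF f])
  have lip: "\<bar>f (x + t *\<^sub>R b) - f x\<bar> \<le> M * t" if t: "0 < t" for x t
  proof -
    obtain s where "f (x + t *\<^sub>R b) - f (x + 0 *\<^sub>R b) = (t - 0) * ?D (x + s *\<^sub>R b)"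
      using MVT2[OF t line[of x]] by blast
    with M[of "x + s *\<^sub>R b"] t show ?thesis
      by (simp add: abs_mult mult_ac mult_left_mono)
  qed
  then have quot: "norm ((f (x + t *\<^sub>R b) - f x) / t) \<le> M" if "0 < t" for x t
    using that by (simp add: pos_divide_le_eq)
  let ?h = "\<lambda>n::nat. 1 / real (Suc n)"
  let ?q = "\<lambda>n x. (f (x + ?h n *\<^sub>R b) - f x) / ?h n"
  have int_f: "integrable lborel f"
  proof -
    have "integrable lborel (\<lambda>x. indicator K x *\<^sub>R f x)"
      using K(1) cf by (intro borel_integrable_compact continuous_on_subset[OF cf]) auto
    also have "(\<lambda>x. indicator K x *\<^sub>R f x) = f"
      using K(3) by (auto simp: fun_eq_iff indicator_def)
    finally show ?thesis .
  qed
  have "(\<lambda>n. \<integral>x. ?q n x \<partial>lborel) \<longlonglongrightarrow> (\<integral>x. ?D x \<partial>lborel)"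
  proof (rule integral_dominated_convergence[where w = "\<lambda>x. M * indicator (cball 0 (R + 1)) x"])
    show "integrable lborel (\<lambda>x. M * indicator (cball 0 (R + 1)) x :: real)"
      by (intro integrable_mult_right integrable_real_indicator) (simp_all add: emeasure_lborel_cball_finite[unfolded infinity_ennreal_def])
    show "AE x in lborel. (\<lambda>n. ?q n x) \<longlonglongrightarrow> ?D x"
    proof (intro AE_I2)
      fix x
      have "((\<lambda>t. (f (x + t *\<^sub>R b) - f x) / t) \<longlongrightarrow> ?D x) (at 0)"
        using line[of x 0] by (simp add: DERIV_def)
      moreover have "filterlim ?h (at 0) sequentially"
        using LIMSEQ_inverse_real_of_nat by (auto simp: filterlim_at inverse_eq_divide)
      ultimately show "(\<lambda>n. ?q n x) \<longlonglongrightarrow> ?D x"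
        by (rule filterlim_compose)
    qed
    fix n
    show "AE x in lborel. norm (?q n x) \<le> M * indicator (cball 0 (R + 1)) x"
    proof (intro AE_I2)
      fix x
      show "norm (?q n x) \<le> M * indicator (cball 0 (R + 1)) x"
      proof (cases "x \<in> cball 0 (R + 1)")
        case True
        then show ?thesis using quot[of "?h n" x] by simp
      next
        case False
        have "norm x \<le> norm (x + ?h n *\<^sub>R b) + norm (?h n *\<^sub>R b)"
          using norm_triangle_ineq4[of "x + ?h n *\<^sub>R b" "?h n *\<^sub>R b"] by simp
        moreover have "norm (?h n *\<^sub>R b) \<le> 1" using b by simp
        ultimately have "norm x \<le> norm (x + ?h n *\<^sub>R b) + 1" by linarith
        moreover have "R + 1 < norm x" using False by simp
        ultimately have "R < norm (x + ?h n *\<^sub>R b)" "R < norm x" by linarith+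
        then have "x \<notin> K" "x + ?h n *\<^sub>R b \<notin> K" using R by (auto simp: subset_eq simp del: of_nat_Suc)
        then show ?thesis using K(3) False by simp
      qed
    qed
  qed auto
  moreover have "(\<integral>x. ?q n x \<partial>lborel) = 0" for n
  proof -
    have eq: "distr lborel borel ((+) (?h n *\<^sub>R b)) = lborel"
      by (rule lborel_distr_plus)
    have "integrable lborel (\<lambda>x. f (?h n *\<^sub>R b + x))"
      using int_f by (subst (asm) eq[symmetric]) (subst (asm) integrable_distr_eq; simp)
    moreover have "(\<integral>x. f (?h n *\<^sub>R b + x) \<partial>lborel) = (\<integral>x. f x \<partial>lborel)"
      by (subst (2) eq[symmetric]) (subst integral_distr; simp)
    ultimately show ?thesis using int_f by (simp add: add.commute)
  qed
  ultimately show ?thesis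
    using LIMSEQ_unique[OF _ tendsto_const] by simp
qed

text \<open>For a test function \<open>\<eta>\<close> the product \<open>u \<eta>\<close> is again a test function, and the integral of its partial
  derivative vanishes.\<close>

lemma has_weak_partial_if_smooth:
  fixes u :: "'a::euclidean_space \<Rightarrow> real"
  assumes u: "\<And>k. Ck k u" and U: "open U" and b: "b \<in> Basis"
  shows "has_weak_partial U b u (\<lambda>x. frechet_derivative u (at x) b)"
  unfolding has_weak_partial_def
proof (intro conjI ballI)
  have cu: "continuous_on UNIV u" and cDu: "continuous_on UNIV (\<lambda>x. frechet_derivative u (at x) b)"
    using u[of 0] Ck_SucD(2)[OF u b, of 0] by auto
  have loc: "locally_integrable_on v U" if "continuous_on UNIV v" for v
    unfolding locally_integrable_on_def set_integrable_def
  proof (intro allI impI)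
    fix K :: "'a set" assume "compact K \<and> K \<subseteq> U"
    then have "integrable lborel (\<lambda>x. indicator K x *\<^sub>R v x)"
      by (intro borel_integrable_compact continuous_on_subset[OF that]) auto
    then show "integrable lebesgue (\<lambda>x. indicator K x *\<^sub>R v x)"
      by (simp add: integrable_completion)
  qed
  show lu: "locally_integrable_on u U" using cu by (rule loc)
  show ldu: "locally_integrable_on (\<lambda>x. frechet_derivative u (at x) b) U" using cDu by (rule loc)
  fix \<eta> :: "'a \<Rightarrow> real"
  assume \<eta>: "\<eta> \<in> test_functions U"
  obtain K where K: "compact K" "K \<subseteq> U" "\<forall>x. x \<notin> K \<longrightarrow> \<eta> x = 0"
    "\<forall>x b. x \<notin> K \<longrightarrow> frechet_derivative \<eta> (at x) b = 0"
    by (rule test_functionsE[OF \<eta>])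
  have prod: "(\<lambda>x. u x * \<eta> x) \<in> test_functions U"
    using u \<eta> by (rule test_functions_mult)
  have D: "frechet_derivative (\<lambda>x. u x * \<eta> x) (at x) b
      = u x * frechet_derivative \<eta> (at x) b + frechet_derivative u (at x) b * \<eta> x" for x
    by (rule fun_cong[OF frechet_derivative_at[OF has_derivative_mult[OF Ck_SucD(1)[OF u] test_function_has_derivative[OF \<eta>]]], symmetric])
  have "(\<integral>x. u x * frechet_derivative \<eta> (at x) b \<partial>lebesgue_on U)
      + (\<integral>x. frechet_derivative u (at x) b * \<eta> x \<partial>lebesgue_on U)
      = (\<integral>x. u x * frechet_derivative \<eta> (at x) b + frechet_derivative u (at x) b * \<eta> x \<partial>lebesgue_on U)"
    by (intro Bochner_Integration.integral_add[symmetric] locally_integrable_on_mult[OF lu U K(1,2)]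
        locally_integrable_on_mult[OF ldu U K(1,2)] test_function_partial_continuous[OF \<eta> b]
        test_function_continuous[OF \<eta>] K(3)[rule_format] K(4)[rule_format])
  also have "\<dots> = (\<integral>x. indicator U x *\<^sub>R frechet_derivative (\<lambda>x. u x * \<eta> x) (at x) b \<partial>lebesgue)"
    using U by (simp add: integral_restrict_space D)
  also have "\<dots> = (\<integral>x. frechet_derivative (\<lambda>x. u x * \<eta> x) (at x) b \<partial>lebesgue)"
    using K by (intro Bochner_Integration.integral_cong) (auto simp: D indicator_def subset_eq)
  also have "\<dots> = 0"
    using test_function_partial_continuous[OF prod b, of UNIV]
    by (subst integral_completion) (auto intro: borel_measurable_continuous_onI integral_partial_test_function_eq_0[OF prod b])
  finally show "(\<integral>x. u x * frechet_derivative \<eta> (at x) b \<partial>lebesgue_on U)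
      = - (\<integral>x. frechet_derivative u (at x) b * \<eta> x \<partial>lebesgue_on U)"
    by linarith
qed


text \<open>Translation of a point of the ball by its diameter \<open>2 * \<rho>\<close> leaves the ball. Hence \<open>\<bar>\<eta> x\<bar>\<close> is at
  most the integral of the partial derivative along the segment of length \<open>2 * \<rho>\<close> that starts in \<open>x\<close>.
  After Tonelli's theorem the inner integrals no longer depend on the position on the segment.\<close>

lemma poincare_test_function:
  fixes \<eta> :: "'a::euclidean_space \<Rightarrow> real"
  assumes \<eta>: "\<eta> \<in> test_functions (ball z \<rho>)" and b: "b \<in> Basis"
  shows "(\<integral>\<^sup>+x. ennreal \<bar>\<eta> x\<bar> \<partial>lborel) \<le>
    ennreal (2 * \<rho>) * (\<integral>\<^sup>+x. ennreal \<bar>frechet_derivative \<eta> (at x) b\<bar> \<partial>lborel)"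
proof (cases "0 < \<rho>")
  case True
  let ?D = "\<lambda>x. frechet_derivative \<eta> (at x) b" and ?T = "2 * \<rho>"
  have cD: "continuous_on UNIV ?D"
    using \<eta> b by (rule test_function_partial_continuous)
  have [measurable]: "?D \<in> borel_measurable borel"
    using cD by (rule borel_measurable_continuous_onI)
  have zero: "\<eta> x = 0" if "x \<notin> ball z \<rho>" for x
    by (rule test_functionsE[OF \<eta>]) (use that in blast)
  have pointwise: "ennreal \<bar>\<eta> x\<bar> \<le> (\<integral>\<^sup>+t. ennreal \<bar>?D (x + t *\<^sub>R b)\<bar> * indicator {0..?T} t \<partial>lborel)" for x
  proof (cases "x \<in> ball z \<rho>")
    case True
    have c: "continuous_on {0..?T} (\<lambda>t. ?D (x + t *\<^sub>R b))"
      by (rule continuous_on_compose2[OF cD]) (auto intro!: continuous_intros)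
    have "x + ?T *\<^sub>R b \<notin> ball z \<rho>"
    proof
      assume "x + ?T *\<^sub>R b \<in> ball z \<rho>"
      with True have "dist x (x + ?T *\<^sub>R b) < \<rho> + \<rho>"
        using dist_triangle3[of x "x + ?T *\<^sub>R b" z] by (simp only: mem_ball)
      then show False using b \<open>0 < \<rho>\<close> by (simp add: dist_norm)
    qed
    then have "\<eta> (x + ?T *\<^sub>R b) = 0" by (rule zero)
    moreover have "(\<integral>t. indicator {0..?T} t *\<^sub>R ?D (x + t *\<^sub>R b) \<partial>lborel)
        = \<eta> (x + ?T *\<^sub>R b) - \<eta> (x + 0 *\<^sub>R b)"
      using \<open>0 < \<rho>\<close> c has_field_derivative_at_within[OF test_function_has_line_derivative[OF \<eta>, of x b]]
      by (intro integral_FTC_Icc) (auto simp: has_real_derivative_iff_has_vector_derivative)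
    ultimately have "\<bar>\<eta> x\<bar> = norm (\<integral>t. indicator {0..?T} t *\<^sub>R ?D (x + t *\<^sub>R b) \<partial>lborel)"
      by simp
    also have "ennreal \<dots> \<le> (\<integral>\<^sup>+t. norm (indicator {0..?T} t *\<^sub>R ?D (x + t *\<^sub>R b)) \<partial>lborel)"
      by (intro integral_norm_bound_ennreal borel_integrable_compact c) simp
    also have "\<dots> = (\<integral>\<^sup>+t. ennreal \<bar>?D (x + t *\<^sub>R b)\<bar> * indicator {0..?T} t \<partial>lborel)"
      by (intro nn_integral_cong) (auto simp: indicator_def)
    finally show ?thesis .
  qed (simp add: zero)
  have "(\<integral>\<^sup>+x. ennreal \<bar>\<eta> x\<bar> \<partial>lborel)
      \<le> (\<integral>\<^sup>+x. \<integral>\<^sup>+t. ennreal \<bar>?D (x + t *\<^sub>R b)\<bar> * indicator {0..?T} t \<partial>lborel \<partial>lborel)"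
    by (intro nn_integral_mono pointwise)
  also have "\<dots> = (\<integral>\<^sup>+t. \<integral>\<^sup>+x. ennreal \<bar>?D (x + t *\<^sub>R b)\<bar> * indicator {0..?T} t \<partial>lborel \<partial>lborel)"
    by (intro lborel_pair.Fubini') measurable
  also have "\<dots> = (\<integral>\<^sup>+t. (\<integral>\<^sup>+x. ennreal \<bar>?D x\<bar> \<partial>lborel) * indicator {0..?T} t \<partial>lborel)"
  proof (intro nn_integral_cong)
    fix t :: real
    have "(\<integral>\<^sup>+x. ennreal \<bar>?D (x + t *\<^sub>R b)\<bar> \<partial>lborel)
        = (\<integral>\<^sup>+x. ennreal \<bar>?D x\<bar> \<partial>distr lborel borel ((+) (t *\<^sub>R b)))"
      by (subst nn_integral_distr) (simp_all add: add.commute)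
    then have "(\<integral>\<^sup>+x. ennreal \<bar>?D (x + t *\<^sub>R b)\<bar> \<partial>lborel) = (\<integral>\<^sup>+x. ennreal \<bar>?D x\<bar> \<partial>lborel)"
      by (simp add: lborel_distr_plus)
    then show "(\<integral>\<^sup>+x. ennreal \<bar>?D (x + t *\<^sub>R b)\<bar> * indicator {0..?T} t \<partial>lborel)
        = (\<integral>\<^sup>+x. ennreal \<bar>?D x\<bar> \<partial>lborel) * indicator {0..?T} t"
      by (subst nn_integral_multc) auto
  qed
  also have "\<dots> = ennreal ?T * (\<integral>\<^sup>+x. ennreal \<bar>?D x\<bar> \<partial>lborel)"
    using True by (subst nn_integral_cmult_indicator) (auto simp: mult.commute)
  finally show ?thesis .
next
  case False
  have "\<eta> x = 0" for x
  proof (rule test_functionsE[OF \<eta>])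
    fix K assume "K \<subseteq> ball z \<rho>" and zero: "\<forall>x. x \<notin> K \<longrightarrow> \<eta> x = 0"
    moreover have "ball z \<rho> = {}" using False by (simp add: ball_eq_empty)
    ultimately have "x \<notin> K" by blast
    with zero show ?thesis by blast
  qed
  then show ?thesis by simp
qed

section \<open>Weak gradients\<close>

lemma locally_integrable_on_diff:
  "locally_integrable_on u U \<Longrightarrow> locally_integrable_on v U \<Longrightarrow> locally_integrable_on (\<lambda>x. u x - v x) U"
  unfolding locally_integrable_on_def by (auto intro: set_integral_diff)

lemma locally_integrable_on_imp_measurable:
  fixes u :: "'a::euclidean_space \<Rightarrow> real"
  assumes "locally_integrable_on u U" "open U"
  shows "u \<in> borel_measurable (lebesgue_on U)"
proof -
  obtain \<D> :: "'a set set" where \<D>: "countable \<D>" "\<And>X. X \<in> \<D> \<Longrightarrow> \<exists>a b. X = cbox a b" "\<Union>\<D> = U"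
    using open_countable_Union_open_cbox[OF \<open>open U\<close>] by metis
  have meas: "u \<in> borel_measurable (restrict_space (lebesgue_on U) X)" if X': "X \<in> \<D>" for X
  proof -
    obtain a b where X: "X = cbox a b" "X \<subseteq> U" using \<D> X' by blast
    then have "u absolutely_integrable_on X"
      using assms by (auto simp: locally_integrable_on_def)
    then have "u \<in> borel_measurable (lebesgue_on X)"
      using X by (simp add: absolutely_integrable_measurable)
    then show ?thesis
      using X(2) by (simp add: restrict_restrict_space assms(2) Int_absorb1 X)
  qed
  have sets: "X \<inter> space (lebesgue_on U) \<in> sets (lebesgue_on U)" if X': "X \<in> \<D>" for X
  proof -
    obtain a b where X: "X = cbox a b" "X \<subseteq> U" using \<D> X' by blast
    then have "X \<inter> space (lebesgue_on U) = X" by (auto simp: space_restrict_space)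
    moreover have "X \<in> sets lebesgue" by (simp add: X)
    ultimately show ?thesis
      using X(2) assms(2) by (simp add: sets_restrict_space_iff)
  qed
  have "space (lebesgue_on U) \<subseteq> \<Union>\<D>"
    using \<D>(3) by (simp add: space_restrict_space)
  from measurable_piecewise_restrict[OF \<D>(1) sets this meas] show ?thesis .
qed

lemma has_weak_partial_diff:
  fixes u :: "'a::euclidean_space \<Rightarrow> real"
  assumes 1: "has_weak_partial U b u v" and 2: "has_weak_partial U b u' v'"
    and U: "open U" and b: "b \<in> Basis"
  shows "has_weak_partial U b (\<lambda>x. u x - u' x) (\<lambda>x. v x - v' x)"
  unfolding has_weak_partial_def
proof (intro conjI ballI)
  note loc = 1[unfolded has_weak_partial_def, THEN conjunct1]
    1[unfolded has_weak_partial_def, THEN conjunct2, THEN conjunct1]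
    2[unfolded has_weak_partial_def, THEN conjunct1]
    2[unfolded has_weak_partial_def, THEN conjunct2, THEN conjunct1]
  show "locally_integrable_on (\<lambda>x. u x - u' x) U" "locally_integrable_on (\<lambda>x. v x - v' x) U"
    by (intro locally_integrable_on_diff loc)+
  fix \<eta> :: "'a \<Rightarrow> real" assume \<eta>: "\<eta> \<in> test_functions U"
  obtain K where K: "compact K" "K \<subseteq> U" "\<forall>x. x \<notin> K \<longrightarrow> \<eta> x = 0"
    "\<forall>x b. x \<notin> K \<longrightarrow> frechet_derivative \<eta> (at x) b = 0"
    by (rule test_functionsE[OF \<eta>])
  have int: "integrable (lebesgue_on U) (\<lambda>x. f x * frechet_derivative \<eta> (at x) b)"
    "integrable (lebesgue_on U) (\<lambda>x. f x * \<eta> x)" if "locally_integrable_on f U" for f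
    using test_function_partial_continuous[OF \<eta> b] test_function_continuous[OF \<eta>] K(3,4)
    by (auto intro!: locally_integrable_on_mult[OF that U K(1,2)])
  have eq: "(\<integral>x. u x * frechet_derivative \<eta> (at x) b \<partial>lebesgue_on U) = - (\<integral>x. v x * \<eta> x \<partial>lebesgue_on U)"
    "(\<integral>x. u' x * frechet_derivative \<eta> (at x) b \<partial>lebesgue_on U) = - (\<integral>x. v' x * \<eta> x \<partial>lebesgue_on U)"
    using 1 2 \<eta> by (auto simp: has_weak_partial_def)
  show "(\<integral>x. (u x - u' x) * frechet_derivative \<eta> (at x) b \<partial>lebesgue_on U)
      = - (\<integral>x. (v x - v' x) * \<eta> x \<partial>lebesgue_on U)"
    by (simp add: left_diff_distrib int loc eq)
qed

text \<open>The difference of two weak derivatives of one function is a weak derivative of \<open>0\<close>, to which the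
  fundamental lemma applies. This makes the choice in the definition of the weak gradient
  irrelevant almost everywhere.\<close>

lemma has_weak_partial_unique:
  fixes u :: "'a::euclidean_space \<Rightarrow> real"
  assumes 1: "has_weak_partial U b u v" and 2: "has_weak_partial U b u v'"
    and U: "open U" and b: "b \<in> Basis"
  shows "AE x in lebesgue_on U. v x = v' x"
proof -
  have *: "has_weak_partial U b (\<lambda>x. 0) (\<lambda>x. v x - v' x)"
    using has_weak_partial_diff[OF assms] by simp
  then have "AE x in lebesgue_on U. v x - v' x = 0"
    by (intro AE_eq_0_if_test_integrals_eq_0[OF U]) (auto simp: has_weak_partial_def)
  then show ?thesis by simp
qed

lemma has_weak_gradient_unique:
  assumes "has_weak_gradient U u v" "has_weak_gradient U u v'" "open U"
  shows "AE x in lebesgue_on U. v x = v' x"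
proof -
  have "AE x in lebesgue_on U. \<forall>b\<in>Basis. v x \<bullet> b = v' x \<bullet> b"
    using assms has_weak_partial_unique
    by (subst AE_finite_all[OF finite_Basis]) (fastforce simp: has_weak_gradient_def)
  then show ?thesis by eventually_elim (rule euclidean_eqI, simp)
qed

lemma has_weak_gradient_diff:
  assumes "has_weak_gradient U u v" "has_weak_gradient U u' v'" "open U"
  shows "has_weak_gradient U (\<lambda>x. u x - u' x) (\<lambda>x. v x - v' x)"
  using assms by (auto simp: has_weak_gradient_def inner_diff_left intro: has_weak_partial_diff)

lemma has_weak_gradient_test_function:
  assumes "\<eta> \<in> test_functions V" "open U"
  shows "has_weak_gradient U \<eta> (gradient \<eta>)"
  using has_weak_partial_if_smooth[OF test_function_Ck[OF assms(1)] assms(2)]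
  by (simp add: has_weak_gradient_def gradient_inner_Basis)

lemma has_weak_gradient_imp_measurable:
  assumes "has_weak_gradient U u v" "open U"
  shows "v \<in> borel_measurable (lebesgue_on U)"
  using assms locally_integrable_on_imp_measurable
  by (subst borel_measurable_euclidean_space) (auto simp: has_weak_gradient_def has_weak_partial_def)

lemma weak_gradientI: "has_weak_gradient U u v \<Longrightarrow> has_weak_gradient U u (weak_gradient U u)"
  unfolding weak_gradient_def by (rule someI[of "has_weak_gradient U u"])

section \<open>Comparison with the Lebesgue norm, and the Poincare inequality for Sobolev functions\<close>

text \<open>The affine lower bound replaces Jensen's inequality. The function \<open>\<lambda>x. \<phi> x (norm (g x))\<close> may fail
  to be measurable, so its lower bound is integrated and not a sum that contains it.\<close>

lemma nn_integral_norm_le_modular: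
  fixes g :: "'a::euclidean_space \<Rightarrow> 'b::euclidean_space"
  assumes g: "g \<in> borel_measurable (lebesgue_on U)" and U: "U \<in> lmeasurable"
    and "0 < c" "0 \<le> s" and low: "\<And>x t. x \<in> U \<Longrightarrow> 0 \<le> t \<Longrightarrow> ennreal (c * (t - s)) \<le> \<phi> x t"
  shows "(\<integral>\<^sup>+x. norm (g x) \<partial>lebesgue_on U)
    \<le> ennreal (1 / c) * (\<integral>\<^sup>+x. \<phi> x (norm (g x)) \<partial>lebesgue_on U) + ennreal (s * measure lebesgue U)"
proof -
  note [measurable] = g
  have "(\<integral>\<^sup>+x. norm (g x) \<partial>lebesgue_on U)
      \<le> (\<integral>\<^sup>+x. ennreal (1 / c) * ennreal (c * (norm (g x) - s)) + ennreal s \<partial>lebesgue_on U)"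
  proof (intro nn_integral_mono)
    fix x
    show "ennreal (norm (g x)) \<le> ennreal (1 / c) * ennreal (c * (norm (g x) - s)) + ennreal s"
    proof (cases "s \<le> norm (g x)")
      case True
      then show ?thesis using assms(3,4) by (simp flip: ennreal_mult ennreal_plus)
    next
      case False
      then show ?thesis by (intro add_increasing) (auto intro: ennreal_leI)
    qed
  qed
  also have "\<dots> = ennreal (1 / c) * (\<integral>\<^sup>+x. ennreal (c * (norm (g x) - s)) \<partial>lebesgue_on U)
      + ennreal (s * measure lebesgue U)"
    using U assms(4) by (subst nn_integral_add) (auto simp: nn_integral_cmult emeasure_restrict_space
        emeasure_eq_measure2 ennreal_mult fmeasurableD)
  also have "\<dots> \<le> ennreal (1 / c) * (\<integral>\<^sup>+x. \<phi> x (norm (g x)) \<partial>lebesgue_on U) + ennreal (s * measure lebesgue U)"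
    using low by (intro add_mono mult_left_mono nn_integral_mono) (auto simp: space_restrict_space)
  finally show ?thesis .
qed

text \<open>Convergence in the Luxemburg norm implies convergence in the Lebesgue space of integrable
  functions: rescale \<open>g\<close> by an admissible \<open>k < \<epsilon>\<close>, for which the modular is at most \<open>1\<close>.\<close>

lemma nn_integral_norm_le_L_phi_norm:
  fixes g :: "'a::euclidean_space \<Rightarrow> 'b::euclidean_space"
  assumes g: "g \<in> borel_measurable (lebesgue_on U)" and U: "U \<in> lmeasurable"
    and "0 < c" "0 \<le> s" and low: "\<And>x t. x \<in> U \<Longrightarrow> 0 \<le> t \<Longrightarrow> ennreal (c * (t - s)) \<le> \<phi> x t"
    and norm: "L_phi_norm \<phi> U g < ennreal \<epsilon>"
  shows "(\<integral>\<^sup>+x. norm (g x) \<partial>lebesgue_on U) \<le> ennreal (\<epsilon> * (1 / c + s * measure lebesgue U))"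
proof -
  note [measurable] = g
  obtain k where k: "0 < k" "(\<integral>\<^sup>+x. \<phi> x (norm (g x) / k) \<partial>lebesgue_on U) \<le> 1" "ennreal k < ennreal \<epsilon>"
    using norm by (auto simp: L_phi_norm_def INF_less_iff)
  then have "k < \<epsilon>" by (simp add: ennreal_less_iff)
  have "(\<integral>\<^sup>+x. norm ((1 / k) *\<^sub>R g x) \<partial>lebesgue_on U)
      \<le> ennreal (1 / c) * (\<integral>\<^sup>+x. \<phi> x (norm ((1 / k) *\<^sub>R g x)) \<partial>lebesgue_on U) + ennreal (s * measure lebesgue U)"
    by (intro nn_integral_norm_le_modular assms) auto
  also have "\<dots> \<le> ennreal (1 / c) * 1 + ennreal (s * measure lebesgue U)"
    using k by (intro add_mono mult_left_mono) auto
  also have "\<dots> = ennreal (1 / c + s * measure lebesgue U)"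
    using assms(3,4) by simp
  finally have "ennreal k * (\<integral>\<^sup>+x. norm ((1 / k) *\<^sub>R g x) \<partial>lebesgue_on U)
      \<le> ennreal k * ennreal (1 / c + s * measure lebesgue U)"
    by (rule mult_left_mono) simp
  also have "ennreal k * (\<integral>\<^sup>+x. norm ((1 / k) *\<^sub>R g x) \<partial>lebesgue_on U) = (\<integral>\<^sup>+x. norm (g x) \<partial>lebesgue_on U)"
    using k(1) by (subst nn_integral_cmult[symmetric]) (auto simp flip: ennreal_mult)
  also have "ennreal k * ennreal (1 / c + s * measure lebesgue U) = ennreal (k * (1 / c + s * measure lebesgue U))"
    using k(1) by (simp add: ennreal_mult')
  also have "\<dots> \<le> ennreal (\<epsilon> * (1 / c + s * measure lebesgue U))"
    using \<open>k < \<epsilon>\<close> assms(3,4) by (intro ennreal_leI mult_right_mono) auto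
  finally show ?thesis .
qed

text \<open>The inequality for test functions passes to the limit, because both parts of the Sobolev norm of
  \<open>w - \<eta>\<close> dominate the corresponding Lebesgue norms. Uniqueness of weak gradients identifies the
  chosen gradient of \<open>w - \<eta>\<close> with the difference of the gradients.\<close>

lemma poincare_W1_phi_0:
  fixes w :: "'a::euclidean_space \<Rightarrow> real" and z :: 'a and \<rho> :: real
  defines "U \<equiv> ball z \<rho> :: 'a set"
  assumes w: "w \<in> W1_phi_0 \<phi> U" and "0 < \<rho>"
    and "0 < c" "0 \<le> s" and low: "\<And>x t. x \<in> U \<Longrightarrow> 0 \<le> t \<Longrightarrow> ennreal (c * (t - s)) \<le> \<phi> x t"
  shows "(\<integral>\<^sup>+x. ennreal \<bar>w x\<bar> \<partial>lebesgue_on U)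
    \<le> ennreal (2 * \<rho>) * (\<integral>\<^sup>+x. norm (weak_gradient U w x) \<partial>lebesgue_on U)"
proof (rule ennreal_le_epsilon)
  fix e :: real assume "0 < e"
  \<comment> \<open>An error \<open>e / C\<close> in the Sobolev norm costs at most \<open>y\<close> in each Lebesgue norm, and \<open>2 * \<rho> * y + y = e\<close>.\<close>
  define D where "D = 1 / c + s * measure lebesgue U"
  define C where "C = (1 + 2 * \<rho>) * D"
  have "0 < C" using assms by (auto simp: C_def D_def intro!: mult_pos_pos add_pos_nonneg)
  define y where "y = e / C * D"
  have y: "0 \<le> y" using \<open>0 < e\<close> \<open>0 < C\<close> assms(3-5) by (auto simp: y_def D_def)
  have U: "open U" "U \<in> lmeasurable" by (auto simp: U_def)
  obtain b :: 'a where b: "b \<in> Basis" using nonempty_Basis by blast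
  have "0 < ennreal (e / C)" using \<open>0 < e\<close> \<open>0 < C\<close> by simp
  moreover have "\<forall>\<epsilon>>0. \<exists>\<eta>\<in>test_functions U. W1_phi_norm \<phi> U (\<lambda>x. w x - \<eta> x) < \<epsilon>"
    using w unfolding W1_phi_0_def by simp
  ultimately obtain \<eta> where \<eta>: "\<eta> \<in> test_functions U"
    and norm: "W1_phi_norm \<phi> U (\<lambda>x. w x - \<eta> x) < ennreal (e / C)"
    by blast
  let ?v = "weak_gradient U w" and ?d = "weak_gradient U (\<lambda>x. w x - \<eta> x)"
  let ?D = "\<lambda>x. frechet_derivative \<eta> (at x) b"
  have v: "has_weak_gradient U w ?v"
    using w by (auto simp: W1_phi_0_def W1_phi_def intro: weak_gradientI)
  have d: "has_weak_gradient U (\<lambda>x. w x - \<eta> x) (\<lambda>x. ?v x - gradient \<eta> x)"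
    by (intro has_weak_gradient_diff v has_weak_gradient_test_function[OF \<eta>] U)
  have AE: "AE x in lebesgue_on U. ?d x = ?v x - gradient \<eta> x"
    using has_weak_gradient_unique[OF weak_gradientI[OF d] d U(1)] .
  have [measurable]: "?v \<in> borel_measurable (lebesgue_on U)" "?d \<in> borel_measurable (lebesgue_on U)"
    using v weak_gradientI[OF d] U by (auto intro: has_weak_gradient_imp_measurable)
  have [measurable]: "\<eta> \<in> borel_measurable (lebesgue_on U)"
    by (intro measurable_restrict_space1 continuous_imp_measurable_lebesgue test_function_continuous[OF \<eta>])
  have [measurable]: "w \<in> borel_measurable (lebesgue_on U)"
    using w by (simp add: W1_phi_0_def W1_phi_def L_phi_def)
  have norms: "L_phi_norm \<phi> U (\<lambda>x. w x - \<eta> x) < ennreal (e / C)" "L_phi_norm \<phi> U ?d < ennreal (e / C)"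
    by (rule le_less_trans[OF _ norm], simp add: W1_phi_norm_def add_increasing add_increasing2)+
  have small_w: "(\<integral>\<^sup>+x. ennreal \<bar>w x - \<eta> x\<bar> \<partial>lebesgue_on U) \<le> ennreal (y)"
    using nn_integral_norm_le_L_phi_norm[OF _ U(2) \<open>0 < c\<close> \<open>0 \<le> s\<close> low norms(1)] by (simp add: y_def D_def)
  have small_d: "(\<integral>\<^sup>+x. norm (?d x) \<partial>lebesgue_on U) \<le> ennreal (y)"
    using nn_integral_norm_le_L_phi_norm[OF _ U(2) \<open>0 < c\<close> \<open>0 \<le> s\<close> low norms(2)] by (simp add: y_def D_def)
  have "(\<integral>\<^sup>+x. ennreal \<bar>?D x\<bar> \<partial>lebesgue_on U) \<le> (\<integral>\<^sup>+x. norm (?v x) + norm (?d x) \<partial>lebesgue_on U)"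
  proof (rule nn_integral_mono_AE)
    show "AE x in lebesgue_on U. ennreal \<bar>?D x\<bar> \<le> ennreal (norm (?v x) + norm (?d x))"
      using AE
    proof eventually_elim
      case (elim x)
      have "\<bar>?D x\<bar> \<le> norm (gradient \<eta> x)"
        using Basis_le_norm[OF b, of "gradient \<eta> x"] by (simp add: gradient_inner_Basis[OF b])
      also have "gradient \<eta> x = ?v x - ?d x" using elim by simp
      also have "norm \<dots> \<le> norm (?v x) + norm (?d x)" by (rule norm_triangle_ineq4)
      finally show ?case by (rule ennreal_leI)
    qed
  qed
  also have "\<dots> = (\<integral>\<^sup>+x. norm (?v x) \<partial>lebesgue_on U) + (\<integral>\<^sup>+x. norm (?d x) \<partial>lebesgue_on U)"
    by (subst nn_integral_add[symmetric]) auto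
  also have "\<dots> \<le> (\<integral>\<^sup>+x. norm (?v x) \<partial>lebesgue_on U) + ennreal (y)"
    by (intro add_left_mono small_d)
  finally have D_le: "(\<integral>\<^sup>+x. ennreal \<bar>?D x\<bar> \<partial>lebesgue_on U)
      \<le> (\<integral>\<^sup>+x. norm (?v x) \<partial>lebesgue_on U) + ennreal (y)" .
  have "(\<integral>\<^sup>+x. ennreal \<bar>\<eta> x\<bar> \<partial>lebesgue_on U) \<le> (\<integral>\<^sup>+x. ennreal \<bar>\<eta> x\<bar> \<partial>lebesgue)"
    using U by (subst nn_integral_restrict_space) (auto intro!: nn_integral_mono simp: indicator_def)
  also have "\<dots> = (\<integral>\<^sup>+x. ennreal \<bar>\<eta> x\<bar> \<partial>lborel)"
    by (rule nn_integral_completion)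
  also have "\<dots> \<le> ennreal (2 * \<rho>) * (\<integral>\<^sup>+x. ennreal \<bar>?D x\<bar> \<partial>lborel)"
    using poincare_test_function[OF \<eta>[unfolded U_def] b] .
  also have "(\<integral>\<^sup>+x. ennreal \<bar>?D x\<bar> \<partial>lborel) = (\<integral>\<^sup>+x. ennreal \<bar>?D x\<bar> \<partial>lebesgue)"
    by (rule nn_integral_completion[symmetric])
  also have "\<dots> = (\<integral>\<^sup>+x. ennreal \<bar>?D x\<bar> \<partial>lebesgue_on U)"
  proof -
    have "?D x = 0" if "x \<notin> U" for x
      by (rule test_functionsE[OF \<eta>]) (use that in blast)
    then show ?thesis
      using U by (subst nn_integral_restrict_space) (auto intro!: nn_integral_cong simp: indicator_def)
  qed
  also have "ennreal (2 * \<rho>) * (\<integral>\<^sup>+x. ennreal \<bar>?D x\<bar> \<partial>lebesgue_on U) \<le> ennreal (2 * \<rho>) *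
      ((\<integral>\<^sup>+x. norm (?v x) \<partial>lebesgue_on U) + ennreal (y))"
    by (intro mult_left_mono D_le) simp
  finally have \<eta>_le: "(\<integral>\<^sup>+x. ennreal \<bar>\<eta> x\<bar> \<partial>lebesgue_on U) \<le> ennreal (2 * \<rho>) *
      ((\<integral>\<^sup>+x. norm (?v x) \<partial>lebesgue_on U) + ennreal (y))" .
  have "(\<integral>\<^sup>+x. ennreal \<bar>w x\<bar> \<partial>lebesgue_on U)
      \<le> (\<integral>\<^sup>+x. ennreal \<bar>\<eta> x\<bar> + ennreal \<bar>w x - \<eta> x\<bar> \<partial>lebesgue_on U)"
    by (intro nn_integral_mono) (auto simp flip: ennreal_plus intro!: ennreal_leI)
  also have "\<dots> = (\<integral>\<^sup>+x. ennreal \<bar>\<eta> x\<bar> \<partial>lebesgue_on U) + (\<integral>\<^sup>+x. ennreal \<bar>w x - \<eta> x\<bar> \<partial>lebesgue_on U)"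
    by (intro nn_integral_add) auto
  also have "\<dots> \<le> ennreal (2 * \<rho>) * ((\<integral>\<^sup>+x. norm (?v x) \<partial>lebesgue_on U)
      + ennreal (y)) + ennreal (y)"
    by (intro add_mono \<eta>_le small_w)
  also have "\<dots> = ennreal (2 * \<rho>) * (\<integral>\<^sup>+x. norm (?v x) \<partial>lebesgue_on U)
      + ennreal (2 * \<rho> * (y) + y)"
    using y \<open>0 < \<rho>\<close> by (subst ennreal_plus) (simp_all only: ennreal_mult distrib_left add.assoc
        mult_nonneg_nonneg less_imp_le zero_le_numeral)
  also have "2 * \<rho> * y + y = e / C * ((1 + 2 * \<rho>) * D)"
    unfolding y_def by (simp add: algebra_simps)
  also have "\<dots> = e"
    using \<open>0 < C\<close> by (simp flip: C_def)
  finally show "(\<integral>\<^sup>+x. ennreal \<bar>w x\<bar> \<partial>lebesgue_on U)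
    \<le> ennreal (2 * \<rho>) * (\<integral>\<^sup>+x. norm (weak_gradient U w x) \<partial>lebesgue_on U) + ennreal e" .
qed

section \<open>Growth of weak Phi-functions\<close>

text \<open>For \<open>t > s\<close> almost monotonicity even gives the bound \<open>m / (L * s) * t\<close>; for \<open>t \<le> s\<close> the affine
  function is not positive and its image in the extended nonnegative reals is \<open>0\<close>. Subtracting
  \<open>s\<close> thus yields one bound for all \<open>t\<close>.\<close>

lemma almost_increasing_lower_bound:
  fixes f :: "real \<Rightarrow> ennreal"
  assumes inc: "almost_increasing_on L {0<..} (\<lambda>t. f t / ennreal t)" and L: "1 \<le> L"
    and s: "0 < s" and m: "0 \<le> m" "ennreal m \<le> f s"
  shows "ennreal (m / (L * s) * (t - s)) \<le> f t"
proof (cases "s < t")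
  case True
  have "f s / ennreal s \<le> ennreal L * (f t / ennreal t)"
    using inc s True by (auto simp: almost_increasing_on_def)
  moreover have "ennreal m / ennreal s \<le> f s / ennreal s"
    using m(2) by (rule divide_right_mono_ennreal)
  ultimately have le: "ennreal (m / s) \<le> ennreal L * (f t / ennreal t)"
    using s m(1) by (simp add: divide_ennreal)
  show ?thesis
  proof (cases "f t")
    case (real a)
    then have "f t / ennreal t = ennreal (a / t)"
      using s True by (simp add: divide_ennreal)
    moreover have "ennreal L * ennreal (a / t) = ennreal (L * (a / t))"
      using L real s True by (intro ennreal_mult[symmetric]) auto
    ultimately have "ennreal (m / s) \<le> ennreal (L * (a / t))"
      using le by simp
    then have "m / s \<le> L * (a / t)"
      using real L s True by (subst (asm) ennreal_le_iff) auto
    then have "m / (L * s) * t \<le> a"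
      using L s True by (simp add: field_simps)
    moreover have "m / (L * s) * (t - s) \<le> m / (L * s) * t"
      using m(1) L s by (intro mult_left_mono) auto
    ultimately show ?thesis using real by (auto intro: ennreal_leI)
  qed simp
next
  case False
  then have "m / (L * s) * (t - s) \<le> 0"
    using m(1) L s by (intro mult_nonneg_nonpos) auto
  then show ?thesis by (simp add: ennreal_neg)
qed

lemma almost_decreasing_le:
  fixes f :: "real \<Rightarrow> ennreal"
  assumes dec: "almost_decreasing_on L {0<..} (\<lambda>t. f t / ennreal (t powr q))" and L: "1 \<le> L"
    and st: "0 < s" "s \<le> t"
  shows "f t \<le> ennreal (L * (t / s) powr q) * f s"
proof -
  have "f t / ennreal (t powr q) \<le> ennreal L * (f s / ennreal (s powr q))"
    using dec st by (auto simp: almost_decreasing_on_def)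
  then have "f t / ennreal (t powr q) * ennreal (t powr q)
      \<le> ennreal L * (f s / ennreal (s powr q)) * ennreal (t powr q)"
    by (rule mult_right_mono) simp
  also have "f t / ennreal (t powr q) * ennreal (t powr q) = f t"
    using st by (intro ennreal_divide_times[THEN trans]) (simp add: ennreal_divide_times divide_ennreal)
  also have "ennreal L * (f s / ennreal (s powr q)) * ennreal (t powr q)
      = ennreal (L * (t / s) powr q) * f s"
  proof -
    have "f s / ennreal (s powr q) = f s * ennreal (1 / s powr q)"
      using st by (simp add: divide_ennreal_def inverse_ennreal inverse_eq_divide)
    moreover have "(t / s) powr q = 1 / s powr q * t powr q"
      using st by (simp add: powr_divide)
    ultimately show ?thesis
      using L by (simp add: ennreal_mult mult_ac del: times_divide_eq_left times_divide_eq_right)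
  qed
  finally show ?thesis .
qed

lemma phi_minus_le: "x \<in> A \<Longrightarrow> phi_minus \<phi> A t \<le> \<phi> x t"
  unfolding phi_minus_def by (rule INF_lower)

lemma phi_plus_ge: "x \<in> A \<Longrightarrow> \<phi> x t \<le> phi_plus \<phi> A t"
  unfolding phi_plus_def by (rule SUP_upper)

lemma phi_plus_le_if_almost_decreasing:
  assumes dec: "\<And>x. almost_decreasing_on L {0<..} (\<lambda>t. \<phi> x t / ennreal (t powr q))" and L: "1 \<le> L"
    and st: "0 < s" "s \<le> t"
  shows "phi_plus \<phi> A t \<le> ennreal (L * (t / s) powr q) * phi_plus \<phi> A s"
  unfolding phi_plus_def[of _ _ t]
proof (rule SUP_least)
  fix x assume "x \<in> A"
  have "\<phi> x t \<le> ennreal (L * (t / s) powr q) * \<phi> x s"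
    using dec L st by (rule almost_decreasing_le)
  also have "\<dots> \<le> ennreal (L * (t / s) powr q) * phi_plus \<phi> A s"
    using \<open>x \<in> A\<close> by (intro mult_left_mono phi_plus_ge) auto
  finally show "\<phi> x t \<le> ennreal (L * (t / s) powr q) * phi_plus \<phi> A s" .
qed

text \<open>The constant factor is positive and finite, hence can be divided out before the infimum is taken.\<close>

lemma phi_minus_le_if_almost_decreasing:
  assumes dec: "\<And>x. almost_decreasing_on L {0<..} (\<lambda>t. \<phi> x t / ennreal (t powr q))" and L: "1 \<le> L"
    and st: "0 < s" "s \<le> t"
  shows "phi_minus \<phi> A t \<le> ennreal (L * (t / s) powr q) * phi_minus \<phi> A s"
proof -
  define k where "k = L * (t / s) powr q"
  have k: "0 < k" using L st by (auto simp: k_def)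
  have cancel: "ennreal (1 / k) * (ennreal k * y) = y" "ennreal k * (ennreal (1 / k) * y) = y" for y
    using k by (simp_all flip: mult.assoc ennreal_mult)
  have "ennreal (1 / k) * phi_minus \<phi> A t \<le> phi_minus \<phi> A s"
    unfolding phi_minus_def[of _ _ s]
  proof (rule INF_greatest)
    fix x assume "x \<in> A"
    then have "phi_minus \<phi> A t \<le> \<phi> x t" by (rule phi_minus_le)
    also have "\<dots> \<le> ennreal k * \<phi> x s"
      unfolding k_def using dec L st by (rule almost_decreasing_le)
    finally have "ennreal (1 / k) * phi_minus \<phi> A t \<le> ennreal (1 / k) * (ennreal k * \<phi> x s)"
      by (rule mult_left_mono) simp
    then show "ennreal (1 / k) * phi_minus \<phi> A t \<le> \<phi> x s" by (simp only: cancel)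
  qed
  then have "ennreal k * (ennreal (1 / k) * phi_minus \<phi> A t) \<le> ennreal k * phi_minus \<phi> A s"
    by (rule mult_left_mono) simp
  then show ?thesis by (simp only: cancel k_def[symmetric])
qed

section \<open>Two-sided capacity estimates\<close>

lemma bounded_in_L_phi:
  fixes g :: "'a::euclidean_space \<Rightarrow> real"
  assumes \<phi>: "weak_Phi UNIV \<phi>" and \<beta>: "0 < \<beta>" "phi_plus \<phi> UNIV \<beta> \<le> 1"
    and U: "U \<in> lmeasurable" and g: "g \<in> borel_measurable (lebesgue_on U)"
    and M: "\<And>x. x \<in> U \<Longrightarrow> \<bar>g x\<bar> \<le> M" "0 < M"
  shows "g \<in> L_phi \<phi> U"
proof -
  have "\<phi> x (\<beta> / M * \<bar>g x\<bar>) \<le> 1" if "x \<in> U" for x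
  proof -
    have "\<beta> / M * \<bar>g x\<bar> \<le> \<beta>"
      using M(1)[OF that] M(2) \<beta>(1) by (simp add: field_simps)
    then have "\<phi> x (\<beta> / M * \<bar>g x\<bar>) \<le> \<phi> x \<beta>"
      using \<phi> \<beta>(1) M(2) by (auto simp: weak_Phi_def mono_on_def)
    also have "\<dots> \<le> 1" using phi_plus_ge[of x UNIV \<phi> \<beta>] \<beta>(2) by (auto intro: order_trans)
    finally show ?thesis .
  qed
  then have "(\<integral>\<^sup>+x. \<phi> x (\<beta> / M * \<bar>g x\<bar>) \<partial>lebesgue_on U) \<le> (\<integral>\<^sup>+x. 1 \<partial>lebesgue_on U)"
    by (intro nn_integral_mono) (simp add: space_restrict_space)
  also have "\<dots> = emeasure lebesgue U"
    using U by (simp add: emeasure_restrict_space space_restrict_space fmeasurableD)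
  also have "\<dots> < \<infinity>"
    using fmeasurableD2[OF U] by (simp only: infinity_ennreal_def less_top)
  finally show ?thesis
    using g \<beta>(1) M(2) unfolding L_phi_def by (auto intro!: exI[of _ "\<beta> / M"])
qed

lemma L_phi_norm_eq_0_if_AE_eq_0:
  fixes g :: "'a::euclidean_space \<Rightarrow> 'b::real_normed_vector"
  assumes \<phi>: "weak_Phi UNIV \<phi>" and g: "AE x in lebesgue_on U. g x = 0"
  shows "L_phi_norm \<phi> U g = 0"
proof -
  have modular: "(\<integral>\<^sup>+x. \<phi> x (norm (g x) / k) \<partial>lebesgue_on U) = 0" for k
  proof -
    have "AE x in lebesgue_on U. \<phi> x (norm (g x) / k) = 0"
      using g by eventually_elim (use \<phi> in \<open>simp add: weak_Phi_def\<close>)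
    then have "(\<integral>\<^sup>+x. \<phi> x (norm (g x) / k) \<partial>lebesgue_on U) = (\<integral>\<^sup>+x. 0 \<partial>lebesgue_on U)"
      by (rule nn_integral_cong_AE)
    then show ?thesis by simp
  qed
  have "L_phi_norm \<phi> U g \<le> 0"
  proof (rule ennreal_le_epsilon)
    fix e :: real assume "0 < e"
    then have "e \<in> {k. 0 < k \<and> (\<integral>\<^sup>+x. \<phi> x (norm (g x) / k) \<partial>lebesgue_on U) \<le> 1}"
      by (simp add: modular)
    then have "L_phi_norm \<phi> U g \<le> ennreal e"
      unfolding L_phi_norm_def by (rule INF_lower)
    then show "L_phi_norm \<phi> U g \<le> 0 + ennreal e" by simp
  qed
  then show ?thesis by simp
qed

text \<open>Test functions approximate themselves. For this the norm of \<open>\<eta> - \<eta>\<close> has to vanish even though its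
  weak gradient is a chosen one, which is \<open>0\<close> only almost everywhere.\<close>

lemma test_function_in_W1_phi_0:
  fixes \<eta> :: "'a::euclidean_space \<Rightarrow> real"
  assumes \<phi>: "weak_Phi UNIV \<phi>" and \<beta>: "0 < \<beta>" "phi_plus \<phi> UNIV \<beta> \<le> 1"
    and U: "U \<in> lmeasurable" "open U" and \<eta>: "\<eta> \<in> test_functions U"
  shows "\<eta> \<in> W1_phi_0 \<phi> U"
proof -
  obtain K where K: "compact K" "K \<subseteq> U" "\<forall>x. x \<notin> K \<longrightarrow> \<eta> x = 0"
    "\<forall>x b. x \<notin> K \<longrightarrow> frechet_derivative \<eta> (at x) b = 0"
    by (rule test_functionsE[OF \<eta>])
  have L: "g \<in> L_phi \<phi> U" if g: "continuous_on UNIV g" "\<forall>x. x \<notin> K \<longrightarrow> g x = 0" for g :: "'a \<Rightarrow> real"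
  proof -
    have "bounded (g ` K)"
      using g(1) K(1) by (meson compact_continuous_image compact_imp_bounded continuous_on_subset subset_UNIV)
    then obtain M where M: "0 < M" "\<And>x. x \<in> K \<Longrightarrow> \<bar>g x\<bar> \<le> M"
      unfolding bounded_pos by auto
    have "\<bar>g x\<bar> \<le> M" for x
      using M g(2) by (cases "x \<in> K") auto
    then show ?thesis
      using bounded_in_L_phi[OF \<phi> \<beta> U(1) _ _ M(1)] g(1)
      by (simp add: continuous_imp_measurable_lebesgue measurable_restrict_space1)
  qed
  have grad: "has_weak_gradient U \<eta> (gradient \<eta>)"
    by (rule has_weak_gradient_test_function[OF \<eta> U(2)])
  have "(\<lambda>x. gradient \<eta> x \<bullet> b) \<in> L_phi \<phi> U" if "b \<in> Basis" for b
    unfolding gradient_inner_Basis[OF that]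
    using test_function_partial_continuous[OF \<eta> that] K(4) by (intro L) auto
  moreover have "\<eta> \<in> L_phi \<phi> U"
    using test_function_continuous[OF \<eta>] K(3) by (intro L) auto
  ultimately have W: "\<eta> \<in> W1_phi \<phi> U"
    using grad by (auto simp: W1_phi_def)
  have "has_weak_gradient U (\<lambda>x. \<eta> x - \<eta> x) (\<lambda>x. gradient \<eta> x - gradient \<eta> x)"
    by (intro has_weak_gradient_diff grad U)
  from has_weak_gradient_unique[OF weak_gradientI[OF this] this U(2)]
  have "AE x in lebesgue_on U. weak_gradient U (\<lambda>x. \<eta> x - \<eta> x) x = 0" by simp
  then have "W1_phi_norm \<phi> U (\<lambda>x. \<eta> x - \<eta> x) = 0"
    unfolding W1_phi_norm_def by (simp add: L_phi_norm_eq_0_if_AE_eq_0[OF \<phi>])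
  then show ?thesis
    using W \<eta> unfolding W1_phi_0_def mem_Collect_eq by metis
qed

text \<open>The radial cutoff is admissible, and its gradient is bounded by \<open>C / r\<close>.\<close>

lemma phi_capacity_ball_le:
  fixes z :: "'a::euclidean_space"
  defines "C \<equiv> 3 * exp (3/2) :: real"
  assumes \<phi>: "weak_Phi UNIV \<phi>" and "A0 UNIV \<phi>" and r: "0 < r"
  shows "phi_capacity \<phi> (ball z r) (ball z (2 * r))
    \<le> phi_plus \<phi> (ball z (2 * r)) (C / r) * emeasure lebesgue (ball z (2 * r))"
proof -
  let ?U = "ball z (2 * r)" and ?w = "radial_cutoff z r"
  obtain \<beta> where \<beta>: "0 < \<beta>" "phi_plus \<phi> UNIV \<beta> \<le> 1"
    using \<open>A0 UNIV \<phi>\<close> by (auto simp: A0_def)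
  have w: "?w \<in> test_functions ?U" using r by (rule radial_cutoff_test_function)
  have "?w \<in> W1_phi_0 \<phi> ?U"
    using w by (intro test_function_in_W1_phi_0[OF \<phi> \<beta>]) auto
  moreover have "\<exists>V. open V \<and> ball z r \<subseteq> V \<and> V \<subseteq> ?U \<and> (\<forall>x\<in>V. 1 \<le> ?w x)"
    using r radial_cutoff_ge_1 by (intro exI[of _ "ball z r"]) auto
  ultimately have "phi_capacity \<phi> (ball z r) ?U \<le> (\<integral>\<^sup>+x. \<phi> x (norm (weak_gradient ?U ?w x)) \<partial>lebesgue_on ?U)"
    unfolding phi_capacity_def by (intro INF_lower) simp
  also have "\<dots> \<le> (\<integral>\<^sup>+x. phi_plus \<phi> ?U (C / r) \<partial>lebesgue_on ?U)"
  proof (rule nn_integral_mono_AE)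
    have grad: "has_weak_gradient ?U ?w (gradient ?w)"
      using w by (rule has_weak_gradient_test_function) simp
    have AE: "AE x in lebesgue_on ?U. weak_gradient ?U ?w x = gradient ?w x"
      using weak_gradientI[OF grad] grad by (rule has_weak_gradient_unique) simp
    have in_U: "AE x in lebesgue_on ?U. x \<in> ?U"
      by (rule AE_I2) (simp add: space_restrict_space)
    show "AE x in lebesgue_on ?U. \<phi> x (norm (weak_gradient ?U ?w x)) \<le> phi_plus \<phi> ?U (C / r)"
      using AE in_U
    proof eventually_elim
      case (elim x)
      have "\<phi> x (norm (gradient ?w x)) \<le> \<phi> x (C / r)"
        using \<phi> norm_gradient_radial_cutoff_le[OF r, of z x] r
        by (auto simp: weak_Phi_def mono_on_def C_def)
      also have "\<dots> \<le> phi_plus \<phi> ?U (C / r)" using elim(2) by (rule phi_plus_ge)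
      finally show ?case using elim(1) by simp
    qed
  qed
  also have "\<dots> = phi_plus \<phi> ?U (C / r) * emeasure lebesgue ?U"
    by (simp add: emeasure_restrict_space space_restrict_space)
  finally show ?thesis .
qed

text \<open>An admissible \<open>w\<close> is at least \<open>1\<close> on \<open>E\<close>, so by the Poincare inequality the mean of the norm of its
  gradient over the ball is at least twice \<open>s\<close>. This surplus makes the affine lower bound for \<open>\<phi>\<close>
  with threshold \<open>s\<close> integrate to a multiple of \<open>\<phi>\<^sup>-(s)\<close> times the volume. Condition (A0) supplies
  the affine lower bound that the Poincare inequality for \<open>w\<close> asks for.\<close>

lemma phi_capacity_ge:
  fixes z :: "'a::euclidean_space"
  assumes \<phi>: "weak_Phi UNIV \<phi>" and "A0 UNIV \<phi>" and L: "1 \<le> L"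
    and inc: "\<And>x. almost_increasing_on L {0<..} (\<lambda>t. \<phi> x t / ennreal t)"
    and \<rho>: "0 < \<rho>" and E: "E \<in> sets lebesgue" "E \<subseteq> ball z \<rho>"
    and s: "0 < s" and dens: "4 * \<rho> * s * measure lebesgue (ball z \<rho>) \<le> measure lebesgue E"
    and m: "0 \<le> m" "ennreal m \<le> phi_minus \<phi> (ball z \<rho>) s"
  shows "ennreal (m / L * measure lebesgue (ball z \<rho>)) \<le> phi_capacity \<phi> E (ball z \<rho>)"
  unfolding phi_capacity_def
proof (rule INF_greatest)
  let ?U = "ball z \<rho>" and ?vol = "measure lebesgue (ball z \<rho>)"
  fix w assume "w \<in> {w \<in> W1_phi_0 \<phi> ?U. \<exists>V. open V \<and> E \<subseteq> V \<and> V \<subseteq> ?U \<and> (\<forall>x\<in>V. 1 \<le> w x)}"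
  then have w: "w \<in> W1_phi_0 \<phi> ?U" and w1: "\<And>x. x \<in> E \<Longrightarrow> 1 \<le> w x" by auto
  let ?v = "weak_gradient ?U w"
  obtain \<beta> where \<beta>: "0 < \<beta>" "1 \<le> phi_minus \<phi> UNIV (1 / \<beta>)"
    using \<open>A0 UNIV \<phi>\<close> by (auto simp: A0_def)
  have "ennreal (1 / (L * (1 / \<beta>)) * (t - 1 / \<beta>)) \<le> \<phi> x t" for x t
    using L inc \<beta> phi_minus_le[of x UNIV \<phi> "1 / \<beta>"]
    by (intro almost_increasing_lower_bound) (auto intro: order_trans)
  then have poincare: "(\<integral>\<^sup>+x. ennreal \<bar>w x\<bar> \<partial>lebesgue_on ?U) \<le> ennreal (2 * \<rho>) * (\<integral>\<^sup>+x. norm (?v x) \<partial>lebesgue_on ?U)"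
    using L \<beta> by (intro poincare_W1_phi_0[OF w \<rho>, of "1 / (L * (1 / \<beta>))" "1 / \<beta>"]) auto
  have "ennreal (4 * \<rho> * s * ?vol) \<le> ennreal (measure lebesgue E)"
    using dens by (rule ennreal_leI)
  also have "ennreal (measure lebesgue E) = emeasure lebesgue E"
  proof -
    have "E \<in> lmeasurable" using E by (meson fmeasurableI2 lmeasurable_ball)
    then show ?thesis by (simp add: emeasure_eq_measure2)
  qed
  also have "\<dots> = (\<integral>\<^sup>+x. indicator E x \<partial>lebesgue_on ?U)"
    using E by (subst nn_integral_indicator) (auto simp: sets_restrict_space_iff emeasure_restrict_space)
  also have "\<dots> \<le> (\<integral>\<^sup>+x. ennreal \<bar>w x\<bar> \<partial>lebesgue_on ?U)"
    using w1 by (intro nn_integral_mono) (force simp: indicator_def)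
  also note poincare
  finally have "ennreal (1 / (2 * \<rho>)) * ennreal (4 * \<rho> * s * ?vol)
      \<le> ennreal (1 / (2 * \<rho>)) * (ennreal (2 * \<rho>) * (\<integral>\<^sup>+x. norm (?v x) \<partial>lebesgue_on ?U))"
    by (rule mult_left_mono) simp
  then have v_ge: "ennreal (2 * s * ?vol) \<le> (\<integral>\<^sup>+x. norm (?v x) \<partial>lebesgue_on ?U)"
    using \<rho> s by (simp flip: ennreal_mult mult.assoc)
  show "ennreal (m / L * ?vol) \<le> (\<integral>\<^sup>+x. \<phi> x (norm (?v x)) \<partial>lebesgue_on ?U)"
  proof (cases "m = 0")
    case False
    then have c: "0 < m / (L * s)" using m(1) L s by auto
    have "has_weak_gradient ?U w ?v"
      using w by (auto simp: W1_phi_0_def W1_phi_def intro: weak_gradientI)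
    then have "?v \<in> borel_measurable (lebesgue_on ?U)"
      by (rule has_weak_gradient_imp_measurable) simp
    moreover have "ennreal (m / (L * s) * (t - s)) \<le> \<phi> x t" if "x \<in> ?U" for x t
      using L inc s m phi_minus_le[OF that, of \<phi> s]
      by (intro almost_increasing_lower_bound) (auto intro: order_trans)
    ultimately have "(\<integral>\<^sup>+x. norm (?v x) \<partial>lebesgue_on ?U)
        \<le> ennreal (1 / (m / (L * s))) * (\<integral>\<^sup>+x. \<phi> x (norm (?v x)) \<partial>lebesgue_on ?U) + ennreal (s * ?vol)"
      using c s by (intro nn_integral_norm_le_modular) auto
    with v_ge have le: "ennreal (2 * s * ?vol)
        \<le> ennreal (L * s / m) * (\<integral>\<^sup>+x. \<phi> x (norm (?v x)) \<partial>lebesgue_on ?U) + ennreal (s * ?vol)"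
      by (auto intro: order_trans)
    show ?thesis
    proof (cases "\<integral>\<^sup>+x. \<phi> x (norm (?v x)) \<partial>lebesgue_on ?U")
      case (real a)
      have "ennreal (L * s / m * a + s * ?vol) = ennreal (L * s / m * a) + ennreal (s * ?vol)"
        using real L s m(1) by (intro ennreal_plus) auto
      also have "ennreal (L * s / m * a) = ennreal (L * s / m) * ennreal a"
        using real L s m(1) by (intro ennreal_mult) auto
      finally have "ennreal (2 * s * ?vol) \<le> ennreal (L * s / m * a + s * ?vol)"
        using le unfolding real by simp
      then have "2 * s * ?vol \<le> L * s / m * a + s * ?vol"
        using real L s m(1) by (subst (asm) ennreal_le_iff) auto
      then have "m / L * ?vol \<le> a"
        using L s m(1) False by (simp add: field_simps)
      then show ?thesis unfolding real by (rule ennreal_leI)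
    qed simp
  qed simp
qed

section \<open>Measure density implies capacity fatness\<close>

text \<open>With \<open>t = 1 / (4 * r)\<close>, the largest argument to which (A1-n) applies on the ball of radius \<open>2 * r\<close>,
  both capacities are compared with \<open>\<phi>\<^sup>-(\<sigma> * t)\<close> times the volume of that ball. The factor \<open>\<sigma>\<close> is the
  one for which the density hypothesis of the lower estimate becomes the measure density
  condition.\<close>

theorem lemma6p4:
  fixes \<Omega> :: "'a::euclidean_space set" and x\<^sub>0 :: 'a
    and \<phi> :: "'a \<Rightarrow> real \<Rightarrow> ennreal" and q :: real
  assumes "open \<Omega>" and "connected \<Omega>" and "bounded \<Omega>" and "x\<^sub>0 \<in> frontier \<Omega>"
    and "weak_Phi UNIV \<phi>" and "A0 UNIV \<phi>" and "A1 UNIV \<phi>" and "A1_n UNIV \<phi>"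
    and "aDec q UNIV \<phi>" and "q < real DIM('a)"
    and "measure_density \<Omega> x\<^sub>0"
  shows "complement_locally_fat \<phi> \<Omega> x\<^sub>0"
proof -
  define n where "n = DIM('a)"
  obtain c R where c: "0 < c" "c < 1" "0 < R" and dens: "\<And>r. 0 < r \<Longrightarrow> r \<le> R \<Longrightarrow>
      c * measure lebesgue (ball x\<^sub>0 r) \<le> measure lebesgue (ball x\<^sub>0 r - \<Omega>)"
    using \<open>measure_density \<Omega> x\<^sub>0\<close> by (auto simp: measure_density_def)
  obtain \<beta> where \<beta>: "0 < \<beta>" "\<beta> < 1" and A1n: "\<And>z r t. 0 < r \<Longrightarrow> t \<in> {1..1 / diameter (ball z r)} \<Longrightarrow>
      phi_plus \<phi> (ball z r) (\<beta> * t) \<le> phi_minus \<phi> (ball z r) t"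
    using \<open>A1_n UNIV \<phi>\<close> by (auto simp: A1_n_def)
  obtain L where L: "1 \<le> L" and inc: "\<And>x. almost_increasing_on L {0<..} (\<lambda>t. \<phi> x t / ennreal t)"
    using \<open>weak_Phi UNIV \<phi>\<close> by (auto simp: weak_Phi_def)
  obtain L' where L': "1 \<le> L'" and dec: "\<And>x. almost_decreasing_on L' {0<..} (\<lambda>t. \<phi> x t / ennreal (t powr q))"
    using \<open>aDec q UNIV \<phi>\<close> by (auto simp: aDec_def)
  define C where "C = 3 * exp (3/2 :: real)"
  have "1 \<le> exp (3/2 :: real)" by simp
  then have C: "1 \<le> C" unfolding C_def by linarith
  \<comment> \<open>The powers of 2 come from the ratio of the volumes of the balls of radius \<open>2 * r\<close> and \<open>r\<close>.\<close>
  define \<sigma> where "\<sigma> = c / (2 * 2 ^ n)"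
  have "(1::real) \<le> 2 ^ n" by simp
  then have "c < 2 * 2 ^ n" using c(2) by linarith
  then have \<sigma>: "0 < \<sigma>" "\<sigma> < 1" using c(1) by (auto simp: \<sigma>_def)
  \<comment> \<open>\<open>K\<close> is the quotient of the constants in the upper and in the lower estimate; \<open>1 / (1 + K)\<close> is below \<open>1\<close>.\<close>
  define K where "K = (L' * (4 * C / \<beta>) powr q) * (L' * (1 / \<sigma>) powr q) * L"
  have K: "0 < K" using L L' \<sigma> C \<beta> by (auto simp: K_def)
  show ?thesis
    unfolding complement_locally_fat_def
  proof (rule exI[of _ "1 / (1 + K)"], rule exI[of _ "min R (1/4)"], intro conjI allI impI)
    fix r assume r: "0 < r \<and> r \<le> min R (1/4)"
    let ?B = "ball x\<^sub>0 (2 * r)" and ?t = "1 / (4 * r)"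
    let ?vol = "measure lebesgue ?B"
    have t: "1 \<le> ?t" "0 < ?t" using r by auto
    have vol: "emeasure lebesgue ?B = ennreal ?vol" by (simp add: emeasure_eq_measure2)
    have "\<beta> * ?t \<le> C / r" using r \<beta> C by (simp add: field_simps)
    then have "phi_plus \<phi> ?B (C / r) \<le> ennreal (L' * (C / r / (\<beta> * ?t)) powr q) * phi_plus \<phi> ?B (\<beta> * ?t)"
      using t \<beta> by (intro phi_plus_le_if_almost_decreasing dec L') auto
    also have "C / r / (\<beta> * ?t) = 4 * C / \<beta>" using r \<beta> by (simp add: field_simps)
    also have "phi_plus \<phi> ?B (\<beta> * ?t) \<le> phi_minus \<phi> ?B ?t"
      using r t by (intro A1n) (auto simp: diameter_ball)
    also have "phi_minus \<phi> ?B ?t \<le> ennreal (L' * (?t / (\<sigma> * ?t)) powr q) * phi_minus \<phi> ?B (\<sigma> * ?t)"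
    proof -
      have "\<sigma> * ?t \<le> ?t" using \<sigma> t by (intro mult_left_le_one_le) auto
      then show ?thesis using t \<sigma> by (intro phi_minus_le_if_almost_decreasing dec L') auto
    qed
    also have "?t / (\<sigma> * ?t) = 1 / \<sigma>" using t by simp
    also have "ennreal (L' * (4 * C / \<beta>) powr q) * (ennreal (L' * (1 / \<sigma>) powr q) * phi_minus \<phi> ?B (\<sigma> * ?t))
        = ennreal (K / L) * phi_minus \<phi> ?B (\<sigma> * ?t)"
      using L L' by (simp add: K_def ennreal_mult mult.assoc)
    finally have plus_le: "phi_plus \<phi> ?B (C / r) \<le> ennreal (K / L) * phi_minus \<phi> ?B (\<sigma> * ?t)"
      by (simp add: mult_left_mono)
    have upper: "phi_capacity \<phi> (ball x\<^sub>0 r) ?B \<le> phi_plus \<phi> ?B (C / r) * ennreal ?vol"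
      using phi_capacity_ball_le[OF \<open>weak_Phi UNIV \<phi>\<close> \<open>A0 UNIV \<phi>\<close>, of r x\<^sub>0] r
      unfolding C_def vol by simp
    let ?E = "ball x\<^sub>0 r - \<Omega>"
    have "?vol = 2 ^ n * measure lebesgue (ball x\<^sub>0 r)"
      using r content_ball_conv_unit_ball[of "2 * r" x\<^sub>0] content_ball_conv_unit_ball[of r x\<^sub>0]
      by (simp add: n_def power_mult_distrib)
    then have "4 * (2 * r) * (\<sigma> * ?t) * ?vol = c * measure lebesgue (ball x\<^sub>0 r)"
      using r by (simp add: \<sigma>_def)
    also have "\<dots> \<le> measure lebesgue ?E" using r by (intro dens) auto
    finally have dens': "4 * (2 * r) * (\<sigma> * ?t) * ?vol \<le> measure lebesgue ?E" .
    have lower: "ennreal (m / L * ?vol) \<le> phi_capacity \<phi> ?E ?B"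
      if "0 \<le> m" "ennreal m \<le> phi_minus \<phi> ?B (\<sigma> * ?t)" for m
    proof (rule phi_capacity_ge[OF \<open>weak_Phi UNIV \<phi>\<close> \<open>A0 UNIV \<phi>\<close> L inc _ _ _ _ dens' that])
      show "?E \<in> sets lebesgue" using \<open>open \<Omega>\<close> by auto
    qed (use r \<sigma> t in auto)
    show "ennreal (1 / (1 + K)) * phi_capacity \<phi> (ball x\<^sub>0 r) ?B \<le> phi_capacity \<phi> ?E ?B"
    \<comment> \<open>If the infimum is infinite, then the lower estimate holds for every real \<open>m\<close>.\<close>
    proof (cases "phi_minus \<phi> ?B (\<sigma> * ?t)")
      case (real m)
      have "phi_capacity \<phi> (ball x\<^sub>0 r) ?B \<le> ennreal (K / L) * ennreal m * ennreal ?vol"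
        using upper mult_right_mono[OF plus_le, of "ennreal ?vol"] unfolding real by (rule order_trans) simp
      also have "\<dots> = ennreal (K * (m / L * ?vol))"
        using K L real by (simp flip: ennreal_mult)
      finally have "ennreal (1 / (1 + K)) * phi_capacity \<phi> (ball x\<^sub>0 r) ?B
          \<le> ennreal (1 / (1 + K)) * ennreal (K * (m / L * ?vol))"
        by (rule mult_left_mono) simp
      also have "\<dots> = ennreal (K / (1 + K) * (m / L * ?vol))"
        using K L real by (simp flip: ennreal_mult)
      also have "\<dots> \<le> ennreal (m / L * ?vol)"
        using K L real by (intro ennreal_leI mult_left_le_one_le) auto
      also have "\<dots> \<le> phi_capacity \<phi> ?E ?B" using real by (intro lower) auto
      finally show ?thesis .
    next
      case top
      have "0 < ?vol" using r by (simp add: content_ball_pos)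
      have unbounded: "ennreal a \<le> phi_capacity \<phi> ?E ?B" if "0 \<le> a" for a
        using lower[of "a * L / ?vol"] that L \<open>0 < ?vol\<close> top by simp
      have "phi_capacity \<phi> ?E ?B = top"
      proof (cases "phi_capacity \<phi> ?E ?B")
        case (real a)
        with unbounded[of "a + 1"] have "ennreal (a + 1) \<le> ennreal a" by simp
        with real show ?thesis by (simp only: ennreal_le_iff)
      qed
      then show ?thesis by simp
    qed
  qed (use K c in auto)
qed

end
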